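(* Let $\alpha_1,\ldots,\alpha_k,\alpha$ be simple types. (1) Every partial numerical function $f:\mathbb{N}^k\rightharpoonup\mathbb{N}$ that is $(\alpha_1,\ldots,\alpha_k,\alpha)$-definable in the $\lambda\mathrm{Y}$-calculus is $(\alpha_1,\ldots,\alpha_k,\alpha)$-definable in the $\lambda\Omega$-calculus. (2) Every total numerical function $f:\mathbb{N}^k\to\mathbb{N}$ that is $(\alpha_1,\ldots,\alpha_k,\alpha)$-definable in the $\lambda\mathrm{Y}$-calculus is $(\alpha_1,\ldots,\alpha_k,\alpha)$-definable in the typed $\lambda\beta\eta$-calculus.
   Context: Simple types are built from a single ground type $o$ using $\to$. The typed $\lambda\beta\eta$-calculus is taken in Church style (each variable $x^\alpha$ carries its type). For a type $\alpha$ let $\omega_\alpha=(\alpha\to\alpha)\to(\alpha\to\alpha)$ and, for $m\in\mathbb{N}$, let the numeral be $\underline{m}_\alpha=\lambda f^{\alpha\to\alpha}.\lambda x^\alpha.f^m(x)$. The $\lambda\Omega$-calculus is the typed $\lambda\beta\eta$-calculus extended with one constant $\Omega:o$ and no additional conversion rules. The $\lambda\mathrm{Y}$-calculus is the typed $\lambda\beta\eta$-calculus extended with constants $\mathrm{Y}_\sigma:(\sigma\to\sigma)\to\sigma$ for every type $\sigma$, with conversions $f(\mathrm{Y}_\sigma f)=\mathrm{Y}_\sigma f$ (reductions $\mathrm{Y}_\sigma f\to f(\mathrm{Y}_\sigma f)$). Definability: in an extension $\lambda^+$ of the $\lambda\beta\eta$-calculus, a closed term $F:\omega_{\alpha_1}\to\cdots\to\omega_{\alpha_k}\to\omega_\alpha$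 $(\alpha_1,\ldots,\alpha_k,\alpha)$-defines a partial function $f:\mathbb{N}^k\rightharpoonup\mathbb{N}$ iff for all $m_1,\ldots,m_k,m\in\mathbb{N}$: $f(m_1,\ldots,m_k)$ is defined and equal to $m$ if and only if $\vdash_{\lambda^+}F\,\underline{m_1}_{\alpha_1}\cdots\underline{m_k}_{\alpha_k}=\underline{m}_\alpha$. A function is $(\alpha_1,\ldots,\alpha_k,\alpha)$-definable in $\lambda^+$ if some such $F$ exists. *)

theory Defs
  imports Main
begin

datatype ty = Ground | Fun ty ty (infixr \<open>\<rightarrow>\<close> 65)

datatype cnst = Omega | Y ty

fun const_ty :: "cnst \<Rightarrow> ty" where
  "const_ty Omega = Ground"
| "const_ty (Y \<sigma>) = (\<sigma> \<rightarrow> \<sigma>) \<rightarrow> \<sigma>"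

text \<open>
  Church-style terms in de Bruijn notation: binders carry the type of the bound variable,
  the types of free variables are given by a context, and \<open>\<alpha>\<close>-equivalent terms are identical.
\<close>

datatype trm = Var nat | Const cnst | App trm trm (infixl \<open>\<cdot>\<close> 200) | Lam ty trm

primrec lift :: "nat \<Rightarrow> trm \<Rightarrow> trm" where
  "lift k (Var i) = (if i < k then Var i else Var (Suc i))"
| "lift k (Const c) = Const c"
| "lift k (s \<cdot> t) = lift k s \<cdot> lift k t"
| "lift k (Lam \<sigma> t) = Lam \<sigma> (lift (Suc k) t)"

text \<open>\<open>subst k u t\<close> replaces variable \<open>k\<close> of \<open>t\<close> by \<open>u\<close> and removes \<open>k\<close> from the context.\<close>

primrec subst :: "nat \<Rightarrow> trm \<Rightarrow> trm \<Rightarrow> trm" where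
  "subst k u (Var i) = (if i < k then Var i else if i = k then u else Var (i - 1))"
| "subst k u (Const c) = Const c"
| "subst k u (s \<cdot> t) = subst k u s \<cdot> subst k u t"
| "subst k u (Lam \<sigma> t) = Lam \<sigma> (subst (Suc k) (lift 0 u) t)"

text \<open>
  A calculus is identified with its set \<open>C\<close> of constants. The conversion rule for \<open>Y\<close> comes with
  the constants \<open>Y \<sigma>\<close>; there is none for \<open>Omega\<close>.
\<close>

definition lambda_beta_eta :: "cnst set" where
  "lambda_beta_eta = {}"

definition lambda_Omega :: "cnst set" where
  "lambda_Omega = {Omega}"

definition lambda_Y :: "cnst set" where
  "lambda_Y = range Y"

inductive has_type :: "cnst set \<Rightarrow> ty list \<Rightarrow> trm \<Rightarrow> ty \<Rightarrow> bool" for C where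
  Var: "i < length \<Gamma> \<Longrightarrow> has_type C \<Gamma> (Var i) (\<Gamma> ! i)"
| Const: "c \<in> C \<Longrightarrow> has_type C \<Gamma> (Const c) (const_ty c)"
| App: "has_type C \<Gamma> s (\<sigma> \<rightarrow> \<tau>) \<Longrightarrow> has_type C \<Gamma> t \<sigma> \<Longrightarrow> has_type C \<Gamma> (s \<cdot> t) \<tau>"
| Lam: "has_type C (\<sigma> # \<Gamma>) t \<tau> \<Longrightarrow> has_type C \<Gamma> (Lam \<sigma> t) (\<sigma> \<rightarrow> \<tau>)"

inductive conv :: "cnst set \<Rightarrow> ty list \<Rightarrow> trm \<Rightarrow> trm \<Rightarrow> ty \<Rightarrow> bool" for C where
  refl: "has_type C \<Gamma> t \<tau> \<Longrightarrow> conv C \<Gamma> t t \<tau>"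
| sym: "conv C \<Gamma> s t \<tau> \<Longrightarrow> conv C \<Gamma> t s \<tau>"
| trans: "conv C \<Gamma> s t \<tau> \<Longrightarrow> conv C \<Gamma> t u \<tau> \<Longrightarrow> conv C \<Gamma> s u \<tau>"
| app: "conv C \<Gamma> s s' (\<sigma> \<rightarrow> \<tau>) \<Longrightarrow> conv C \<Gamma> t t' \<sigma> \<Longrightarrow> conv C \<Gamma> (s \<cdot> t) (s' \<cdot> t') \<tau>"
| lam: "conv C (\<sigma> # \<Gamma>) t t' \<tau> \<Longrightarrow> conv C \<Gamma> (Lam \<sigma> t) (Lam \<sigma> t') (\<sigma> \<rightarrow> \<tau>)"
| beta: "has_type C (\<sigma> # \<Gamma>) s \<tau> \<Longrightarrow> has_type C \<Gamma> t \<sigma> \<Longrightarrow> conv C \<Gamma> (Lam \<sigma> s \<cdot> t) (subst 0 t s) \<tau>"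
| eta: "has_type C \<Gamma> t (\<sigma> \<rightarrow> \<tau>) \<Longrightarrow> conv C \<Gamma> (Lam \<sigma> (lift 0 t \<cdot> Var 0)) t (\<sigma> \<rightarrow> \<tau>)"
| Y: "Y \<sigma> \<in> C \<Longrightarrow> has_type C \<Gamma> f (\<sigma> \<rightarrow> \<sigma>) \<Longrightarrow>
        conv C \<Gamma> (f \<cdot> (Const (Y \<sigma>) \<cdot> f)) (Const (Y \<sigma>) \<cdot> f) \<sigma>"

text \<open>
  In the Church-style calculus typed variables are always available, so an equation between closed
  terms may be derived through open terms. Hence the context in \<open>provably_equal\<close> is existentially
  quantified. Weakening a closed term is the identity, as contexts are extended at their end.
\<close>

definition provably_equal :: "cnst set \<Rightarrow> trm \<Rightarrow> trm \<Rightarrow> bool" where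
  "provably_equal C s t \<longleftrightarrow> (\<exists>\<Gamma> \<tau>. conv C \<Gamma> s t \<tau>)"

definition omega :: "ty \<Rightarrow> ty" where
  "omega \<alpha> = (\<alpha> \<rightarrow> \<alpha>) \<rightarrow> (\<alpha> \<rightarrow> \<alpha>)"

definition church :: "ty \<Rightarrow> nat \<Rightarrow> trm" where
  "church \<alpha> m = Lam (\<alpha> \<rightarrow> \<alpha>) (Lam \<alpha> (((\<cdot>) (Var 1) ^^ m) (Var 0)))"

text \<open>
  A partial function of arity \<open>length \<alpha>s\<close> is a map on lists, of which only the values on lists of
  that length matter.
\<close>

definition defines_fun :: "cnst set \<Rightarrow> ty list \<Rightarrow> ty \<Rightarrow> trm \<Rightarrow> (nat list \<Rightarrow> nat option) \<Rightarrow> bool" where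
  "defines_fun C \<alpha>s \<alpha> F f \<longleftrightarrow>
     has_type C [] F (foldr (\<rightarrow>) (map omega \<alpha>s) (omega \<alpha>)) \<and>
     (\<forall>ms m. length ms = length \<alpha>s \<longrightarrow>
        (f ms = Some m \<longleftrightarrow>
         provably_equal C (foldl (\<cdot>) F (map2 church \<alpha>s ms)) (church \<alpha> m)))"

definition definable :: "cnst set \<Rightarrow> ty list \<Rightarrow> ty \<Rightarrow> (nat list \<Rightarrow> nat option) \<Rightarrow> bool" where
  "definable C \<alpha>s \<alpha> f \<longleftrightarrow> (\<exists>F. defines_fun C \<alpha>s \<alpha> F f)"

lemma has_type_church: "has_type C \<Gamma> (church \<alpha> m) (omega \<alpha>)"
proof -
  let ?\<Delta> = "\<alpha> # (\<alpha> \<rightarrow> \<alpha>) # \<Gamma>"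
  have 0: "has_type C ?\<Delta> (Var 0) \<alpha>" and 1: "has_type C ?\<Delta> (Var 1) (\<alpha> \<rightarrow> \<alpha>)"
    using has_type.Var[of 0 ?\<Delta> C] has_type.Var[of 1 ?\<Delta> C] by auto
  have "has_type C ?\<Delta> (((\<cdot>) (Var 1) ^^ m) (Var 0)) \<alpha>"
    by (induction m) (use 0 1 in \<open>auto intro: has_type.App\<close>)
  then show ?thesis
    unfolding church_def omega_def by (intro has_type.Lam)
qed

lemma has_type_lift:
  assumes "has_type C (\<Delta> @ \<Gamma>) t \<tau>"
  shows "has_type C (\<Delta> @ \<sigma> # \<Gamma>) (lift (length \<Delta>) t) \<tau>"
  using assms
proof (induction "\<Delta> @ \<Gamma>" t \<tau> arbitrary: \<Delta> rule: has_type.induct)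
  case (Var i)
  then show ?case
    using has_type.Var[of i "\<Delta> @ \<sigma> # \<Gamma>" C] has_type.Var[of "Suc i" "\<Delta> @ \<sigma> # \<Gamma>" C]
    by (auto simp: nth_append Suc_diff_le)
next
  case (Lam \<rho> t \<tau>)
  from Lam.hyps(2)[of "\<rho> # \<Delta>"] show ?case
    by (auto intro: has_type.Lam)
qed (auto intro: has_type.intros)

lemma has_type_subst:
  assumes "has_type C (\<Delta> @ \<sigma> # \<Gamma>) t \<tau>" and "has_type C (\<Delta> @ \<Gamma>) u \<sigma>"
  shows "has_type C (\<Delta> @ \<Gamma>) (subst (length \<Delta>) u t) \<tau>"
  using assms
proof (induction "\<Delta> @ \<sigma> # \<Gamma>" t \<tau> arbitrary: \<Delta> u rule: has_type.induct)
  case (Var i)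
  consider "i < length \<Delta>" | "i = length \<Delta>" | j where "i = Suc (length \<Delta> + j)"
    by (metis less_imp_Suc_add linorder_neqE_nat)
  then show ?case
  proof cases
    case 1
    then show ?thesis
      using has_type.Var[of i "\<Delta> @ \<Gamma>" C] by (simp add: nth_append)
  next
    case 2
    then show ?thesis
      using Var by simp
  next
    case 3
    then show ?thesis
      using Var has_type.Var[of "length \<Delta> + j" "\<Delta> @ \<Gamma>" C] by (simp add: nth_append)
  qed
next
  case (Lam \<rho> t \<tau>)
  have "has_type C ((\<rho> # \<Delta>) @ \<Gamma>) (lift 0 u) \<sigma>"
    using has_type_lift[of C "[]" "\<Delta> @ \<Gamma>" u \<sigma> \<rho>] Lam.prems by simp
  from Lam.hyps(2)[OF _ this] show ?case
    by (auto intro: has_type.Lam)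
qed (auto intro: has_type.intros)

lemma conv_has_type:
  "conv C \<Gamma> s t \<tau> \<Longrightarrow> has_type C \<Gamma> s \<tau> \<and> has_type C \<Gamma> t \<tau>"
proof (induction rule: conv.induct)
  case (beta \<sigma> \<Gamma> s \<tau> t)
  then show ?case
    using has_type_subst[of C "[]" \<sigma> \<Gamma> s \<tau> t] by (auto intro: has_type.intros)
next
  case (eta \<Gamma> t \<sigma> \<tau>)
  then show ?case
    using has_type_lift[of C "[]" \<Gamma> t "\<sigma> \<rightarrow> \<tau>" \<sigma>] has_type.Var[of 0 "\<sigma> # \<Gamma>" C]
    by (auto intro!: has_type.Lam intro: has_type.App)
next
  case (Y \<sigma> \<Gamma> f)
  then show ?case
    using has_type.Const[of "Y \<sigma>" C \<Gamma>] by (auto intro: has_type.App)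
qed (auto intro: has_type.intros)

end

theory Submission
  imports Defs
begin

text \<open>
  Let \<open>F\<^sub>n\<close> be \<open>F\<close> with every \<open>Y\<close> replaced by \<open>\<lambda>f. f\<^sup>n \<Omega>\<close>. Whether the normal form of a term
  contains \<open>\<Omega>\<close> can be read off its value in the hierarchy of monotone functions over the
  two-element order. All domains of this model are finite, so for some \<open>n\<close> the terms \<open>F\<close> and \<open>F\<^sub>n\<close>
  have the same value. Hence, if \<open>F\<close> applied to some numerals equals a numeral, then \<open>F\<^sub>n\<close> applied to
  them has an \<open>\<Omega>\<close>-free normal form, with the same \<open>n\<close> for all arguments. As \<open>F\<^sub>n\<close> approximates \<open>F\<close> and
  an \<open>\<Omega>\<close>-free term approximates nothing but itself, \<open>F\<close> and \<open>F\<^sub>n\<close> yield the same numeral. The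
  approximation order is a Kripke logical relation that compares ground terms up to conversion
  whenever the left one is total in the model; this makes confluence and normalisation superfluous.

  If the function is total, \<open>\<Omega>\<close> never survives, and any term of ground type may take its place. Under
  the binders of a numeral \<open>\<lambda>f x z\<^sub>1 \<dots> z\<^sub>p. \<dots>\<close> there is one, namely \<open>x z\<^sub>1 \<dots> z\<^sub>p\<close>.
\<close>

section \<open>Simultaneous substitution\<close>

abbreviation up :: "(nat \<Rightarrow> trm) \<Rightarrow> nat \<Rightarrow> trm" where
  "up \<rho> \<equiv> case_nat (Var 0) (\<lambda>i. lift 0 (\<rho> i))"

text \<open>Replacing constants together with variables lets one operation cover lifting, single
  substitution, the unrolling of \<open>Y\<close> and the elimination of \<open>Omega\<close>. The
  images of constants may be open terms, so they are lifted under a binder too.\<close>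

primrec sub :: "(cnst \<Rightarrow> trm) \<Rightarrow> (nat \<Rightarrow> trm) \<Rightarrow> trm \<Rightarrow> trm" where
  "sub \<delta> \<rho> (Var i) = \<rho> i"
| "sub \<delta> \<rho> (Const c) = \<delta> c"
| "sub \<delta> \<rho> (s \<cdot> t) = sub \<delta> \<rho> s \<cdot> sub \<delta> \<rho> t"
| "sub \<delta> \<rho> (Lam \<sigma> t) = Lam \<sigma> (sub (\<lambda>c. lift 0 (\<delta> c)) (up \<rho>) t)"

lemma lift_lift: "i \<le> k \<Longrightarrow> lift (Suc k) (lift i t) = lift i (lift k t)"
  by (induction t arbitrary: i k) auto

lemma sub_lift: "sub \<delta> \<rho> (lift k t) = sub \<delta> (\<lambda>i. \<rho> (if i < k then i else Suc i)) t"
proof (induction t arbitrary: \<delta> \<rho> k)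
  case (Lam \<sigma> t)
  have "(\<lambda>i. up \<rho> (if i < Suc k then i else Suc i)) = up (\<lambda>i. \<rho> (if i < k then i else Suc i))"
    by (auto split: nat.split)
  then show ?case
    by (simp add: Lam)
qed auto

lemma lift_sub: "lift k (sub \<delta> \<rho> t) = sub (\<lambda>c. lift k (\<delta> c)) (\<lambda>i. lift k (\<rho> i)) t"
proof (induction t arbitrary: \<delta> \<rho> k)
  case (Lam \<sigma> t)
  have "(\<lambda>i. lift (Suc k) (up \<rho> i)) = up (\<lambda>i. lift k (\<rho> i))"
    by (auto simp: lift_lift split: nat.split)
  then show ?case
    by (simp add: Lam lift_lift)
qed auto

lemma sub_up_lift [simp]:
  "sub (\<lambda>c. lift 0 (\<delta> c)) (up \<rho>) (lift 0 t) = lift 0 (sub \<delta> \<rho> t)"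
  by (simp add: sub_lift lift_sub)

lemma sub_sub:
  "sub \<delta> \<rho> (sub \<delta>' \<rho>' t) = sub (\<lambda>c. sub \<delta> \<rho> (\<delta>' c)) (\<lambda>i. sub \<delta> \<rho> (\<rho>' i)) t"
proof (induction t arbitrary: \<delta> \<rho> \<delta>' \<rho>')
  case (Lam \<sigma> t)
  have "(\<lambda>i. sub (\<lambda>c. lift 0 (\<delta> c)) (up \<rho>) (up \<rho>' i)) = up (\<lambda>i. sub \<delta> \<rho> (\<rho>' i))"
    by (auto split: nat.split)
  then show ?case
    by (simp add: Lam)
qed auto

lemma case_nat_Var [simp]: "case_nat (Var 0) (\<lambda>i. Var (Suc i)) = Var"
  by (auto split: nat.split)

lemma sub_Const_Var [simp]: "sub Const Var t = t"
  by (induction t) auto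

lemma lift_eq_sub: "lift k t = sub Const (\<lambda>i. Var (if i < k then i else Suc i)) t"
  using sub_lift[of Const Var k t] by simp

lemma lift_0_eq_sub: "lift 0 t = sub Const (\<lambda>i. Var (Suc i)) t"
  by (simp add: lift_eq_sub)

lemma subst_eq_sub:
  "subst k u t = sub Const (\<lambda>i. if i < k then Var i else if i = k then u else Var (i - 1)) t"
proof (induction t arbitrary: k u)
  case (Lam \<sigma> t)
  have "up (\<lambda>i. if i < k then Var i else if i = k then u else Var (i - 1)) =
      (\<lambda>i. if i < Suc k then Var i else if i = Suc k then lift 0 u else Var (i - 1))"
    by (auto split: nat.split)
  then show ?case
    by (simp add: Lam)
qed auto

lemma subst_0_eq_sub: "subst 0 u t = sub Const (case_nat u Var) t"
proof -
  have "(\<lambda>i. if i < 0 then Var i else if i = 0 then u else Var (i - 1)) = case_nat u Var"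
    by (auto split: nat.split)
  then show ?thesis
    by (simp only: subst_eq_sub)
qed

lemma sub_case_nat_lift: "sub \<delta> (case_nat u \<rho>) (lift 0 t) = sub \<delta> \<rho> t"
  by (simp add: sub_lift)

lemma subst_0_sub_up:
  "subst 0 u (sub (\<lambda>c. lift 0 (\<delta> c)) (up \<rho>) s) = sub \<delta> (case_nat u \<rho>) s"
proof -
  have "(\<lambda>i. sub Const (case_nat u Var) (up \<rho> i)) = case_nat u \<rho>"
    by (auto simp: sub_case_nat_lift split: nat.split)
  then show ?thesis
    by (simp add: subst_0_eq_sub sub_sub sub_case_nat_lift)
qed

lemma sub_subst_0: "sub \<delta> \<rho> (subst 0 t s) = sub \<delta> (case_nat (sub \<delta> \<rho> t) \<rho>) s"
proof -
  have "(\<lambda>i. sub \<delta> \<rho> (case_nat t Var i)) = case_nat (sub \<delta> \<rho> t) \<rho>"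
    by (auto simp: sub_case_nat_lift split: nat.split)
  then show ?thesis
    by (simp add: subst_0_eq_sub sub_sub sub_case_nat_lift)
qed

lemma sub_foldl_app: "sub \<delta> \<rho> (foldl (\<cdot>) s ts) = foldl (\<cdot>) (sub \<delta> \<rho> s) (map (sub \<delta> \<rho>) ts)"
  by (induction ts arbitrary: s) auto


section \<open>Typing and conversion under substitution\<close>

inductive_cases has_type_VarE [elim!]: "has_type C \<Gamma> (Var i) \<tau>"
inductive_cases has_type_ConstE [elim!]: "has_type C \<Gamma> (Const c) \<tau>"
inductive_cases has_type_AppE: "has_type C \<Gamma> (s \<cdot> t) \<tau>"
inductive_cases has_type_LamE: "has_type C \<Gamma> (Lam \<sigma> t) \<tau>"

text \<open>The constant sets may differ, as the type of a constant does not depend on the calculus.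
  This lets terms be compared across calculi.\<close>

lemma has_type_unique: "has_type C \<Gamma> t \<tau> \<Longrightarrow> has_type C' \<Gamma> t \<tau>' \<Longrightarrow> \<tau> = \<tau>'"
proof (induction arbitrary: \<tau>' rule: has_type.induct)
  case (App \<Gamma> s \<sigma> \<tau> t)
  from App.prems obtain \<sigma>' where "has_type C' \<Gamma> s (\<sigma>' \<rightarrow> \<tau>')"
    by (rule has_type_AppE)
  then show ?case
    using App.IH(1) by blast
next
  case (Lam \<sigma> \<Gamma> t \<tau>)
  from Lam.prems show ?case
    by (rule has_type_LamE) (use Lam.IH in blast)
qed auto

lemma has_type_lift_0: "has_type C \<Gamma> t \<tau> \<Longrightarrow> has_type C (\<sigma> # \<Gamma>) (lift 0 t) \<tau>"
  using has_type_lift[of C "[]" \<Gamma> t \<tau> \<sigma>] by simp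

lemma has_type_Var_0: "has_type C (\<sigma> # \<Gamma>) (Var 0) \<sigma>"
  using has_type.Var[of 0 "\<sigma> # \<Gamma>" C] by simp

definition sub_typed :: "cnst set \<Rightarrow> ty list \<Rightarrow> (nat \<Rightarrow> trm) \<Rightarrow> ty list \<Rightarrow> bool" where
  "sub_typed C \<Delta> \<rho> \<Gamma> \<longleftrightarrow> (\<forall>i<length \<Gamma>. has_type C \<Delta> (\<rho> i) (\<Gamma> ! i))"

lemma sub_typed_case_nat:
  "has_type C \<Delta> u \<sigma> \<Longrightarrow> sub_typed C \<Delta> \<rho> \<Gamma> \<Longrightarrow> sub_typed C \<Delta> (case_nat u \<rho>) (\<sigma> # \<Gamma>)"
  by (auto simp: sub_typed_def nth_Cons split: nat.split)

lemma sub_typed_up: "sub_typed C \<Delta> \<rho> \<Gamma> \<Longrightarrow> sub_typed C (\<sigma> # \<Delta>) (up \<rho>) (\<sigma> # \<Gamma>)"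
  by (rule sub_typed_case_nat) (auto simp: sub_typed_def intro: has_type_lift_0 has_type_Var_0)

lemma sub_typed_Var: "sub_typed C (\<Gamma> @ \<Delta>) Var \<Gamma>"
proof -
  have "has_type C (\<Gamma> @ \<Delta>) (Var i) (\<Gamma> ! i)" if "i < length \<Gamma>" for i
    using has_type.Var[of i "\<Gamma> @ \<Delta>" C] that by (simp add: nth_append)
  then show ?thesis
    by (simp add: sub_typed_def)
qed

lemma has_type_sub:
  assumes "has_type C \<Gamma> t \<tau>" "sub_typed C' \<Delta> \<rho> \<Gamma>" "\<And>c. c \<in> C \<Longrightarrow> has_type C' \<Delta> (\<delta> c) (const_ty c)"
  shows "has_type C' \<Delta> (sub \<delta> \<rho> t) \<tau>"
  using assms
proof (induction arbitrary: \<Delta> \<delta> \<rho> rule: has_type.induct)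
  case (App \<Gamma> s \<sigma> \<tau> t)
  show ?case
    unfolding sub.simps
    by (rule has_type.App; rule App.IH, rule App.prems, erule App.prems)
next
  case (Lam \<sigma> \<Gamma> t \<tau>)
  show ?case
    using Lam.IH[OF sub_typed_up[OF Lam.prems(1)] has_type_lift_0[OF Lam.prems(2)]]
    by (auto intro: has_type.Lam)
qed (auto simp: sub_typed_def)

lemma sub_cong:
  assumes "has_type C \<Gamma> t \<tau>" "\<And>i. i < length \<Gamma> \<Longrightarrow> \<rho> i = \<rho>' i" "\<And>c. c \<in> C \<Longrightarrow> \<delta> c = \<delta>' c"
  shows "sub \<delta> \<rho> t = sub \<delta>' \<rho>' t"
  using assms
proof (induction arbitrary: \<delta> \<rho> \<delta>' \<rho>' rule: has_type.induct)
  case (App \<Gamma> s \<sigma> \<tau> t)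
  show ?case
    unfolding sub.simps by (rule arg_cong2[of _ _ _ _ "(\<cdot>)"]; rule App.IH; fact App.prems)
next
  case (Lam \<sigma> \<Gamma> t \<tau>)
  have "up \<rho> i = up \<rho>' i" if "i < length (\<sigma> # \<Gamma>)" for i
    using that Lam.prems(1)[of "i - 1"] by (cases i) auto
  moreover have "lift 0 (\<delta> c) = lift 0 (\<delta>' c)" if "c \<in> C" for c
    using Lam.prems(2)[OF that] by simp
  ultimately have "sub (\<lambda>c. lift 0 (\<delta> c)) (up \<rho>) t = sub (\<lambda>c. lift 0 (\<delta>' c)) (up \<rho>') t"
    by (rule Lam.IH)
  then show ?case
    by simp
qed auto

lemma sub_ident:
  assumes "has_type C \<Gamma> t \<tau>" "\<And>i. i < length \<Gamma> \<Longrightarrow> \<rho> i = Var i" "\<And>c. c \<in> C \<Longrightarrow> \<delta> c = Const c"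
  shows "sub \<delta> \<rho> t = t"
  using sub_cong[of C \<Gamma> t \<tau> \<rho> Var \<delta> Const] assms by simp

lemma lift_closed: "has_type C [] t \<tau> \<Longrightarrow> lift k t = t"
  unfolding lift_eq_sub by (erule sub_ident) auto

lemma has_type_weaken:
  assumes "has_type C \<Gamma> t \<tau>" "C \<subseteq> C'"
  shows "has_type C' (\<Gamma> @ \<Delta>) t \<tau>"
  using has_type_sub[OF assms(1) sub_typed_Var[of C' \<Gamma> \<Delta>], of Const] assms(2)
  by (auto intro: has_type.Const)

lemma has_type_closed: "has_type C [] t \<tau> \<Longrightarrow> has_type C \<Gamma> t \<tau>"
  using has_type_weaken[of C "[]" t \<tau> C \<Gamma>] by simp

lemma conv_sub_beta:
  assumes "has_type C (\<sigma> # \<Delta>) (sub (\<lambda>c. lift 0 (\<delta> c)) (up \<rho>) s) \<tau>" "has_type C \<Delta> u \<sigma>"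
  shows "conv C \<Delta> (sub \<delta> \<rho> (Lam \<sigma> s) \<cdot> u) (sub \<delta> (case_nat u \<rho>) s) \<tau>"
  using conv.beta[OF assms] by (simp add: subst_0_sub_up)

text \<open>\<open>Omega\<close> has no conversion rule, so it may be sent to any term of its type;
  the fixed point constants have to be kept for their rule to survive.\<close>

lemma conv_sub:
  assumes "conv C \<Gamma> s t \<tau>" "sub_typed C' \<Delta> \<rho> \<Gamma>"
    and "\<And>c. c \<in> C \<Longrightarrow> has_type C' \<Delta> (\<delta> c) (const_ty c)"
    and "\<And>\<sigma>. Y \<sigma> \<in> C \<Longrightarrow> \<delta> (Y \<sigma>) = Const (Y \<sigma>) \<and> Y \<sigma> \<in> C'"
  shows "conv C' \<Delta> (sub \<delta> \<rho> s) (sub \<delta> \<rho> t) \<tau>"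
  using assms
proof (induction arbitrary: \<Delta> \<delta> \<rho> rule: conv.induct)
  case (refl \<Gamma> t \<tau>)
  then show ?case
    by (intro conv.refl has_type_sub)
next
  case (sym \<Gamma> s t \<tau>)
  show ?case
    by (rule conv.sym, rule sym.IH, (fact sym.prems)+)
next
  case (trans \<Gamma> s t \<tau> u)
  show ?case
    by (rule conv.trans; rule trans.IH, (fact trans.prems)+)
next
  case (app \<Gamma> s s' \<sigma> \<tau> t t')
  show ?case
    unfolding sub.simps by (rule conv.app; rule app.IH, (fact app.prems)+)
next
  case (lam \<sigma> \<Gamma> t t' \<tau>)
  show ?case
    using lam.IH[OF sub_typed_up[OF lam.prems(1)] has_type_lift_0[OF lam.prems(2)]] lam.prems(3)
    by (auto intro: conv.lam)
next
  case (beta \<sigma> \<Gamma> s \<tau> t)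
  have "has_type C' (\<sigma> # \<Delta>) (sub (\<lambda>c. lift 0 (\<delta> c)) (up \<rho>) s) \<tau>" "has_type C' \<Delta> (sub \<delta> \<rho> t) \<sigma>"
    by (rule has_type_sub, rule beta, rule sub_typed_up, rule beta, rule has_type_lift_0, erule beta)
      (rule has_type_sub, rule beta, rule beta, erule beta)
  from conv_sub_beta[OF this] show ?case
    by (simp add: sub_subst_0)
next
  case (eta \<Gamma> t \<sigma> \<tau>)
  show ?case
    using conv.eta[OF has_type_sub[OF eta.hyps eta.prems(1,2)]] by simp
next
  case (Y \<sigma> \<Gamma> f)
  show ?case
    using conv.Y[OF _ has_type_sub[OF Y.hyps(2) Y.prems(1,2)]] Y.prems(3)[OF Y.hyps(1)] by simp
qed

lemma conv_weaken:
  assumes "conv C \<Gamma> s t \<tau>" "C \<subseteq> C'"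
  shows "conv C' (\<Gamma> @ \<Delta>) s t \<tau>"
  using conv_sub[OF assms(1) sub_typed_Var[of C' \<Gamma> \<Delta>], of Const] assms(2)
  by (auto intro: has_type.Const)

lemma conv_ext:
  assumes "conv C (\<sigma> # \<Gamma>) (lift 0 s \<cdot> Var 0) (lift 0 t \<cdot> Var 0) \<tau>"
    and "has_type C \<Gamma> s (\<sigma> \<rightarrow> \<tau>)" "has_type C \<Gamma> t (\<sigma> \<rightarrow> \<tau>)"
  shows "conv C \<Gamma> s t (\<sigma> \<rightarrow> \<tau>)"
  using conv.trans[OF conv.sym[OF conv.eta[OF assms(2)]]
      conv.trans[OF conv.lam[OF assms(1)] conv.eta[OF assms(3)]]] .

text \<open>Extensionality for a fresh variable at the end of the context, where the worlds of
  \<open>approx\<close> grow. A renaming moves that variable to the front, where it can be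
  abstracted.\<close>

lemma conv_ext_last:
  assumes "conv C (\<Gamma> @ [\<sigma>]) (s \<cdot> Var (length \<Gamma>)) (t \<cdot> Var (length \<Gamma>)) \<tau>"
    and s: "has_type C \<Gamma> s (\<sigma> \<rightarrow> \<tau>)" and t: "has_type C \<Gamma> t (\<sigma> \<rightarrow> \<tau>)"
  shows "conv C \<Gamma> s t (\<sigma> \<rightarrow> \<tau>)"
proof (rule conv_ext[OF _ s t])
  let ?\<rho> = "\<lambda>i. if i < length \<Gamma> then Var (Suc i) else Var 0"
  have "sub_typed C (\<sigma> # \<Gamma>) ?\<rho> (\<Gamma> @ [\<sigma>])"
    using has_type.Var[of "Suc _" "\<sigma> # \<Gamma>" C] has_type_Var_0
    by (auto simp: sub_typed_def nth_append)
  from conv_sub[OF assms(1) this, of Const]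
  have "conv C (\<sigma> # \<Gamma>) (sub Const ?\<rho> s \<cdot> Var 0) (sub Const ?\<rho> t \<cdot> Var 0) \<tau>"
    by (simp add: has_type.Const)
  moreover have "sub Const ?\<rho> u = lift 0 u" if "has_type C \<Gamma> u (\<sigma> \<rightarrow> \<tau>)" for u
    unfolding lift_eq_sub by (rule sub_cong[OF that]) auto
  ultimately show "conv C (\<sigma> # \<Gamma>) (lift 0 s \<cdot> Var 0) (lift 0 t \<cdot> Var 0) \<tau>"
    using s t by simp
qed


section \<open>A finite model\<close>

text \<open>
  The hierarchy of monotone functions over the two-element order. All types of the hierarchy live
  in a single HOL type, so functions are represented by their graphs, listed in a fixed order of
  the arguments to make the representation unique.
\<close>

datatype val = B bool | T "(val \<times> val) list"

fun ap :: "val \<Rightarrow> val \<Rightarrow> val" where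
  "ap (T xs) a = the (map_of xs a)"
| "ap (B b) a = B b"

definition tab :: "val set \<Rightarrow> (val \<Rightarrow> val) \<Rightarrow> val" where
  "tab A f = T (map (\<lambda>a. (a, f a)) (SOME xs. set xs = A))"

fun vals :: "ty \<Rightarrow> val set" and vle :: "ty \<Rightarrow> val \<Rightarrow> val \<Rightarrow> bool" where
  "vals Ground = range B"
| "vals (\<sigma> \<rightarrow> \<tau>) = {tab (vals \<sigma>) f |f. (\<forall>a\<in>vals \<sigma>. f a \<in> vals \<tau>) \<and>
     (\<forall>a\<in>vals \<sigma>. \<forall>b\<in>vals \<sigma>. vle \<sigma> a b \<longrightarrow> vle \<tau> (f a) (f b))}"
| "vle Ground a b \<longleftrightarrow> a = B False \<or> b = B True"
| "vle (\<sigma> \<rightarrow> \<tau>) f g \<longleftrightarrow> (\<forall>a\<in>vals \<sigma>. vle \<tau> (ap f a) (ap g a))"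

lemma set_some_list: "finite A \<Longrightarrow> set (SOME xs. set xs = A) = A"
  using finite_list by (rule someI_ex)

text \<open>A table over a finite domain is a list of fixed length over finitely many pairs.\<close>

lemma finite_vals [simp]: "finite (vals \<sigma>)"
proof (induction \<sigma>)
  case (Fun \<sigma> \<tau>)
  let ?xs = "SOME xs. set xs = vals \<sigma>"
  have "vals (\<sigma> \<rightarrow> \<tau>) \<subseteq> T ` {xs. set xs \<subseteq> vals \<sigma> \<times> vals \<tau> \<and> length xs = length ?xs}"
    using set_some_list[OF Fun.IH(1)] by (auto simp: tab_def intro!: imageI)
  moreover have "finite {xs. set xs \<subseteq> vals \<sigma> \<times> vals \<tau> \<and> length xs = length ?xs}"
    using Fun.IH by (intro finite_lists_length_eq finite_cartesian_product)
  ultimately show ?case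
    by (meson finite_imageI finite_subset)
qed auto

lemma ap_tab [simp]: "a \<in> vals \<sigma> \<Longrightarrow> ap (tab (vals \<sigma>) f) a = f a"
  by (simp add: tab_def map_of_map_restrict set_some_list)

lemma tab_cong: "(\<And>a. a \<in> vals \<sigma> \<Longrightarrow> f a = g a) \<Longrightarrow> tab (vals \<sigma>) f = tab (vals \<sigma>) g"
  by (simp add: tab_def set_some_list)

lemma tab_in_vals:
  assumes "\<And>a. a \<in> vals \<sigma> \<Longrightarrow> f a \<in> vals \<tau>"
    and "\<And>a b. a \<in> vals \<sigma> \<Longrightarrow> b \<in> vals \<sigma> \<Longrightarrow> vle \<sigma> a b \<Longrightarrow> vle \<tau> (f a) (f b)"
  shows "tab (vals \<sigma>) f \<in> vals (\<sigma> \<rightarrow> \<tau>)"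
  using assms by auto

lemma ap_in_vals: "f \<in> vals (\<sigma> \<rightarrow> \<tau>) \<Longrightarrow> a \<in> vals \<sigma> \<Longrightarrow> ap f a \<in> vals \<tau>"
  by auto

lemma ap_mono:
  "f \<in> vals (\<sigma> \<rightarrow> \<tau>) \<Longrightarrow> a \<in> vals \<sigma> \<Longrightarrow> b \<in> vals \<sigma> \<Longrightarrow> vle \<sigma> a b \<Longrightarrow> vle \<tau> (ap f a) (ap f b)"
  by auto

lemma tab_ap: "f \<in> vals (\<sigma> \<rightarrow> \<tau>) \<Longrightarrow> tab (vals \<sigma>) (ap f) = f"
  by (auto intro!: tab_cong)

lemma vals_ext:
  assumes "f \<in> vals (\<sigma> \<rightarrow> \<tau>)" "g \<in> vals (\<sigma> \<rightarrow> \<tau>)" "\<And>a. a \<in> vals \<sigma> \<Longrightarrow> ap f a = ap g a"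
  shows "f = g"
  using tab_cong[of \<sigma> "ap f" "ap g"] assms by (simp only: tab_ap)

lemma vle_refl: "a \<in> vals \<sigma> \<Longrightarrow> vle \<sigma> a a"
  by (induction \<sigma> arbitrary: a) (auto simp del: vals.simps(2) dest: ap_in_vals)

lemma vle_trans:
  "a \<in> vals \<sigma> \<Longrightarrow> b \<in> vals \<sigma> \<Longrightarrow> c \<in> vals \<sigma> \<Longrightarrow> vle \<sigma> a b \<Longrightarrow> vle \<sigma> b c \<Longrightarrow> vle \<sigma> a c"
proof (induction \<sigma> arbitrary: a b c)
  case (Fun \<sigma> \<tau>)
  show ?case
    unfolding vle.simps using Fun.IH(2) Fun.prems by (meson ap_in_vals vle.simps(2))
qed auto

lemma vle_antisym: "a \<in> vals \<sigma> \<Longrightarrow> b \<in> vals \<sigma> \<Longrightarrow> vle \<sigma> a b \<Longrightarrow> vle \<sigma> b a \<Longrightarrow> a = b"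
proof (induction \<sigma> arbitrary: a b)
  case (Fun \<sigma> \<tau>)
  show ?case
    using Fun.prems(1,2) by (rule vals_ext) (meson Fun ap_in_vals vle.simps(2))
qed auto

primrec vbot :: "ty \<Rightarrow> val" where
  "vbot Ground = B False"
| "vbot (\<sigma> \<rightarrow> \<tau>) = tab (vals \<sigma>) (\<lambda>_. vbot \<tau>)"

lemma vbot_in_vals [simp]: "vbot \<sigma> \<in> vals \<sigma>"
  by (induction \<sigma>) (auto intro: vle_refl)

lemma vbot_le: "a \<in> vals \<sigma> \<Longrightarrow> vle \<sigma> (vbot \<sigma>) a"
  by (induction \<sigma> arbitrary: a) auto

lemma iterate_in_vals: "f \<in> vals (\<sigma> \<rightarrow> \<sigma>) \<Longrightarrow> (ap f ^^ n) (vbot \<sigma>) \<in> vals \<sigma>"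
  by (induction n) (auto simp del: vals.simps intro: ap_in_vals)

text \<open>The iterates of bottom form an ascending chain. Among the first
  \<open>Suc (card (vals \<sigma>))\<close> of them two coincide; by antisymmetry the chain stops
  growing at the earlier one and is constant from there on.\<close>

lemma iterate_stable:
  assumes f: "f \<in> vals (\<sigma> \<rightarrow> \<sigma>)" and n: "card (vals \<sigma>) \<le> n"
  shows "(ap f ^^ n) (vbot \<sigma>) = (ap f ^^ card (vals \<sigma>)) (vbot \<sigma>)"
proof -
  define x where "x n = (ap f ^^ n) (vbot \<sigma>)" for n
  have x_in: "x n \<in> vals \<sigma>" for n
    unfolding x_def using f by (rule iterate_in_vals)
  have step: "vle \<sigma> (x n) (x (Suc n))" for n
  proof (induction n)
    case 0
    then show ?case
      using x_in[of 1] by (simp add: x_def vbot_le)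
  next
    case (Suc n)
    then show ?case
      using ap_mono[OF f x_in x_in Suc] by (simp add: x_def)
  qed
  have mono: "vle \<sigma> (x m) (x n)" if "m \<le> n" for m n
    using that by (induction rule: dec_induct) (auto intro: vle_refl vle_trans step x_in)
  have "\<not> inj_on x {..card (vals \<sigma>)}"
  proof
    assume "inj_on x {..card (vals \<sigma>)}"
    then have "card {..card (vals \<sigma>)} \<le> card (vals \<sigma>)"
      using x_in by (intro card_inj_on_le[of x]) auto
    then show False
      by simp
  qed
  then obtain i j where ij: "i < j" "j \<le> card (vals \<sigma>)" "x i = x j"
    unfolding inj_on_def by (metis atMost_iff linorder_neqE_nat)
  then have fixed: "x (Suc i) = x i"
    using mono[of "Suc i" j] step[of i] by (intro vle_antisym[OF x_in x_in]) auto
  have stable: "x n = x i" if "i \<le> n" for n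
    using that by (induction rule: dec_induct) (use fixed in \<open>auto simp: x_def\<close>)
  show ?thesis
    using stable[of n] stable[of "card (vals \<sigma>)"] ij n by (simp add: x_def)
qed

text \<open>By \<open>iterate_stable\<close> this number of iterations reaches the least fixed point
  of every monotone \<open>f\<close>, so \<open>Y \<sigma>\<close> denotes the least fixed point
  operator.\<close>

fun cval :: "cnst \<Rightarrow> val" where
  "cval Omega = B False"
| "cval (Y \<sigma>) = tab (vals (\<sigma> \<rightarrow> \<sigma>)) (\<lambda>f. (ap f ^^ card (vals \<sigma>)) (vbot \<sigma>))"

primrec eval :: "(nat \<Rightarrow> val) \<Rightarrow> trm \<Rightarrow> val" where
  "eval \<eta> (Var i) = \<eta> i"
| "eval \<eta> (Const c) = cval c"
| "eval \<eta> (s \<cdot> t) = ap (eval \<eta> s) (eval \<eta> t)"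
| "eval \<eta> (Lam \<sigma> t) = tab (vals \<sigma>) (\<lambda>a. eval (case_nat a \<eta>) t)"

definition env_ok :: "ty list \<Rightarrow> (nat \<Rightarrow> val) \<Rightarrow> bool" where
  "env_ok \<Gamma> \<eta> \<longleftrightarrow> (\<forall>i<length \<Gamma>. \<eta> i \<in> vals (\<Gamma> ! i))"

lemma env_ok_case_nat: "env_ok \<Gamma> \<eta> \<Longrightarrow> a \<in> vals \<sigma> \<Longrightarrow> env_ok (\<sigma> # \<Gamma>) (case_nat a \<eta>)"
  by (auto simp: env_ok_def nth_Cons split: nat.split)

lemma iterate_mono:
  assumes "f \<in> vals (\<sigma> \<rightarrow> \<sigma>)" "g \<in> vals (\<sigma> \<rightarrow> \<sigma>)" "vle (\<sigma> \<rightarrow> \<sigma>) f g"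
  shows "vle \<sigma> ((ap f ^^ n) (vbot \<sigma>)) ((ap g ^^ n) (vbot \<sigma>))"
proof (induction n)
  case (Suc n)
  let ?x = "(ap f ^^ n) (vbot \<sigma>)" and ?y = "(ap g ^^ n) (vbot \<sigma>)"
  have "?x \<in> vals \<sigma>" "?y \<in> vals \<sigma>"
    using assms by (auto simp del: vals.simps intro: iterate_in_vals)
  then have "vle \<sigma> (ap f ?x) (ap g ?y)"
    using assms Suc by (meson ap_in_vals ap_mono vle.simps(2) vle_trans)
  then show ?case
    by simp
qed (simp add: vle_refl)

lemma cval_in_vals: "cval c \<in> vals (const_ty c)"
proof (cases c)
  case (Y \<sigma>)
  show ?thesis
    unfolding Y cval.simps const_ty.simps
    by (rule tab_in_vals) (auto simp del: vals.simps vle.simps intro: iterate_in_vals iterate_mono)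
qed auto

text \<open>Membership and monotonicity depend on each other: an abstraction has a value in
  \<open>vals\<close> only if its body is monotone in the bound variable, and an application is
  monotone because the values of its function part are.\<close>

lemma eval_in_vals_mono:
  assumes "has_type C \<Gamma> t \<tau>" "env_ok \<Gamma> \<eta>" "env_ok \<Gamma> \<eta>'" "\<And>i. i < length \<Gamma> \<Longrightarrow> vle (\<Gamma> ! i) (\<eta> i) (\<eta>' i)"
  shows "eval \<eta> t \<in> vals \<tau> \<and> vle \<tau> (eval \<eta> t) (eval \<eta>' t)"
  using assms
proof (induction arbitrary: \<eta> \<eta>' rule: has_type.induct)
  case (Var i \<Gamma>)
  then show ?case
    by (simp add: env_ok_def)
next
  case (Const c \<Gamma>)
  then show ?case
    by (simp add: cval_in_vals vle_refl)
next
  case (App \<Gamma> s \<sigma> \<tau> t)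
  note refl = vle_refl[OF App.prems(2)[unfolded env_ok_def, rule_format]]
  have "eval \<eta>' s \<in> vals (\<sigma> \<rightarrow> \<tau>)" "eval \<eta>' t \<in> vals \<sigma>"
    using App.IH App.prems(2) refl by blast+
  moreover have "eval \<eta> s \<in> vals (\<sigma> \<rightarrow> \<tau>)" "eval \<eta> t \<in> vals \<sigma>"
    "vle (\<sigma> \<rightarrow> \<tau>) (eval \<eta> s) (eval \<eta>' s)" "vle \<sigma> (eval \<eta> t) (eval \<eta>' t)"
    using App.IH App.prems by blast+
  ultimately show ?case
    unfolding eval.simps by (meson ap_in_vals ap_mono vle.simps(2) vle_trans)
next
  case (Lam \<sigma> \<Gamma> t \<tau>)
  have *: "eval (case_nat a \<eta>) t \<in> vals \<tau> \<and> vle \<tau> (eval (case_nat a \<eta>) t) (eval (case_nat b \<eta>') t)"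
    if "a \<in> vals \<sigma>" "b \<in> vals \<sigma>" "vle \<sigma> a b" "env_ok \<Gamma> \<eta>" "env_ok \<Gamma> \<eta>'"
      "\<And>i. i < length \<Gamma> \<Longrightarrow> vle (\<Gamma> ! i) (\<eta> i) (\<eta>' i)" for a b \<eta> \<eta>'
    using that by (intro Lam.IH) (auto simp: nth_Cons intro: env_ok_case_nat split: nat.split)
  have refl: "vle (\<Gamma> ! i) (\<eta> i) (\<eta> i)" if "i < length \<Gamma>" for i
    using that Lam.prems(1) by (simp add: env_ok_def vle_refl)
  have "eval \<eta> (Lam \<sigma> t) \<in> vals (\<sigma> \<rightarrow> \<tau>)"
    unfolding eval.simps
    by (rule tab_in_vals) (use * vle_refl Lam.prems(1) refl in blast)+
  moreover have "vle (\<sigma> \<rightarrow> \<tau>) (eval \<eta> (Lam \<sigma> t)) (eval \<eta>' (Lam \<sigma> t))"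
    using *[OF _ _ _ Lam.prems] vle_refl by simp
  ultimately show ?case
    by blast
qed

lemma eval_in_vals: "has_type C \<Gamma> t \<tau> \<Longrightarrow> env_ok \<Gamma> \<eta> \<Longrightarrow> eval \<eta> t \<in> vals \<tau>"
  using eval_in_vals_mono[of C \<Gamma> t \<tau> \<eta> \<eta>] by (simp add: env_ok_def vle_refl)

lemma eval_lift: "eval \<eta> (lift k t) = eval (\<lambda>i. \<eta> (if i < k then i else Suc i)) t"
proof (induction t arbitrary: \<eta> k)
  case (Lam \<sigma> t)
  have "(\<lambda>i. case_nat a \<eta> (if i < Suc k then i else Suc i)) =
      case_nat a (\<lambda>i. \<eta> (if i < k then i else Suc i))" for a
    by (auto split: nat.split)
  then show ?case
    by (simp add: Lam)
qed auto

primrec consts_of :: "trm \<Rightarrow> cnst set" where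
  "consts_of (Var i) = {}"
| "consts_of (Const c) = {c}"
| "consts_of (s \<cdot> t) = consts_of s \<union> consts_of t"
| "consts_of (Lam \<sigma> t) = consts_of t"

lemma finite_consts: "finite (consts_of t)"
  by (induction t) auto

text \<open>Only constants occurring in \<open>t\<close> are tested, since an unrolling of fixed
  depth is guaranteed to have the value of \<open>Y \<sigma>\<close> only if the domain of
  \<open>\<sigma>\<close> is small enough.\<close>

lemma eval_sub:
  "(\<And>c. c \<in> consts_of t \<Longrightarrow> eval \<eta> (\<delta> c) = cval c) \<Longrightarrow>
    eval \<eta> (sub \<delta> \<rho> t) = eval (\<lambda>i. eval \<eta> (\<rho> i)) t"
proof (induction t arbitrary: \<eta> \<delta> \<rho>)
  case (Lam \<sigma> t)
  have "(\<lambda>i. eval (case_nat a \<eta>) (up \<rho> i)) = case_nat a (\<lambda>i. eval \<eta> (\<rho> i))" for a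
    by (auto simp: eval_lift split: nat.split)
  then show ?case
    using Lam by (simp add: eval_lift)
qed auto

lemma eval_cong:
  assumes "has_type C \<Gamma> t \<tau>" "\<And>i. i < length \<Gamma> \<Longrightarrow> \<eta> i = \<eta>' i"
  shows "eval \<eta> t = eval \<eta>' t"
  using assms
proof (induction arbitrary: \<eta> \<eta>' rule: has_type.induct)
  case (App \<Gamma> s \<sigma> \<tau> t)
  show ?case
    unfolding eval.simps by (rule arg_cong2[of _ _ _ _ ap]; rule App.IH; fact App.prems)
next
  case (Lam \<sigma> \<Gamma> t \<tau>)
  have "case_nat a \<eta> i = case_nat a \<eta>' i" if "i < length (\<sigma> # \<Gamma>)" for a i
    using that Lam.prems[of "i - 1"] by (cases i) auto
  then have "eval (case_nat a \<eta>) t = eval (case_nat a \<eta>') t" for a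
    by (rule Lam.IH)
  then show ?case
    by simp
qed auto

text \<open>Soundness of the model. Eta holds because graphs are unique, and the \<open>Y\<close>
  rule because one further iteration after \<open>card (vals \<sigma>)\<close> many changes
  nothing.\<close>

lemma eval_conv: "conv C \<Gamma> s t \<tau> \<Longrightarrow> env_ok \<Gamma> \<eta> \<Longrightarrow> eval \<eta> s = eval \<eta> t"
proof (induction arbitrary: \<eta> rule: conv.induct)
  case (lam \<sigma> \<Gamma> t t' \<tau>)
  show ?case
    unfolding eval.simps by (rule tab_cong, rule lam.IH, rule env_ok_case_nat, rule lam.prems)
next
  case (beta \<sigma> \<Gamma> s \<tau> t)
  have "(\<lambda>i. eval \<eta> (case_nat t Var i)) = case_nat (eval \<eta> t) \<eta>"
    by (auto split: nat.split)
  then show ?case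
    using eval_in_vals[OF beta(2) beta.prems] by (simp add: subst_0_eq_sub eval_sub)
next
  case (eta \<Gamma> t \<sigma> \<tau>)
  then show ?case
    using tab_ap[OF eval_in_vals] by (simp add: eval_lift)
next
  case (Y \<sigma> \<Gamma> f)
  have f: "eval \<eta> f \<in> vals (\<sigma> \<rightarrow> \<sigma>)"
    using Y(2,3) by (rule eval_in_vals)
  then show ?case
    using iterate_stable[OF f, of "Suc (card (vals \<sigma>))"] by (simp del: vals.simps)
qed auto

text \<open>
  A term in long normal form evaluates to a \<^emph>\<open>total\<close> value, when its free variables are interpreted
  by \<open>vtop\<close>, iff \<open>Omega\<close> does not occur in it: the variables test all their arguments.
\<close>

fun vtop :: "ty \<Rightarrow> val" and vtotal :: "ty \<Rightarrow> val \<Rightarrow> bool" where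
  "vtop Ground = B True"
| "vtop (\<sigma> \<rightarrow> \<tau>) = tab (vals \<sigma>) (\<lambda>a. if vtotal \<sigma> a then vtop \<tau> else vbot \<tau>)"
| "vtotal Ground a \<longleftrightarrow> a = B True"
| "vtotal (\<sigma> \<rightarrow> \<tau>) f \<longleftrightarrow> vtotal \<tau> (ap f (vtop \<sigma>))"

text \<open>A joint induction: \<open>vtop\<close> at a function type is monotone because totality
  of its argument is upward closed, and upward closure evaluates functions at \<open>vtop\<close>,
  which must therefore be in the domain.\<close>

lemma vtop_in_vals_total_mono:
  "vtop \<sigma> \<in> vals \<sigma> \<and> (\<forall>a\<in>vals \<sigma>. \<forall>b\<in>vals \<sigma>. vle \<sigma> a b \<longrightarrow> vtotal \<sigma> a \<longrightarrow> vtotal \<sigma> b)"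
proof (induction \<sigma>)
  case (Fun \<sigma> \<tau>)
  have "vtop (\<sigma> \<rightarrow> \<tau>) \<in> vals (\<sigma> \<rightarrow> \<tau>)"
    unfolding vtop.simps by (rule tab_in_vals) (use Fun.IH vbot_le vle_refl in auto)
  moreover have "vtotal (\<sigma> \<rightarrow> \<tau>) g"
    if "f \<in> vals (\<sigma> \<rightarrow> \<tau>)" "g \<in> vals (\<sigma> \<rightarrow> \<tau>)" "vle (\<sigma> \<rightarrow> \<tau>) f g" "vtotal (\<sigma> \<rightarrow> \<tau>) f" for f g
    using that Fun.IH by (meson ap_in_vals vtotal.simps(2) vle.simps(2))
  ultimately show ?case
    by blast
qed auto

lemmas vtop_in_vals [simp] = vtop_in_vals_total_mono[THEN conjunct1]

text \<open>Totality as a logical predicate: closed under application by definition, it fits an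
  induction over terms. It holds of \<open>vtop\<close> and implies \<open>vtotal\<close>.\<close>

primrec hereditarily_total :: "ty \<Rightarrow> val \<Rightarrow> bool" where
  "hereditarily_total Ground a \<longleftrightarrow> a = B True"
| "hereditarily_total (\<sigma> \<rightarrow> \<tau>) f \<longleftrightarrow>
     (\<forall>a\<in>vals \<sigma>. hereditarily_total \<sigma> a \<longrightarrow> hereditarily_total \<tau> (ap f a))"

lemma hereditarily_total_vtop_and_imp_total:
  "hereditarily_total \<sigma> (vtop \<sigma>) \<and> (\<forall>a. hereditarily_total \<sigma> a \<longrightarrow> vtotal \<sigma> a)"
  by (induction \<sigma>) auto

definition top_env :: "ty list \<Rightarrow> nat \<Rightarrow> val" where
  "top_env \<Gamma> i = vtop (\<Gamma> ! i)"

lemma env_ok_top_env [simp]: "env_ok \<Gamma> (top_env \<Gamma>)"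
  by (simp add: env_ok_def top_env_def)

lemma eval_top_env_append:
  "has_type C \<Gamma> t \<tau> \<Longrightarrow> eval (top_env (\<Gamma> @ \<Delta>)) t = eval (top_env \<Gamma>) t"
  by (erule eval_cong) (simp add: top_env_def nth_append)

text \<open>The fundamental lemma of this predicate, for terms without constants; among them are the
  numerals.\<close>

lemma pure_hereditarily_total:
  assumes "has_type {} \<Gamma> t \<tau>" "env_ok \<Gamma> \<eta>" "\<And>i. i < length \<Gamma> \<Longrightarrow> hereditarily_total (\<Gamma> ! i) (\<eta> i)"
  shows "hereditarily_total \<tau> (eval \<eta> t)"
  using assms
proof (induction arbitrary: \<eta> rule: has_type.induct)
  case (App \<Gamma> s \<sigma> \<tau> t)
  then show ?case
    using eval_in_vals[OF App.hyps(2)] by auto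
next
  case (Lam \<sigma> \<Gamma> t \<tau>)
  have "hereditarily_total \<tau> (eval (case_nat a \<eta>) t)" if "a \<in> vals \<sigma>" "hereditarily_total \<sigma> a" for a
    using that Lam.prems by (intro Lam.IH) (auto simp: nth_Cons intro: env_ok_case_nat split: nat.split)
  then show ?case
    by simp
qed auto

lemma total_pure: "has_type {} \<Gamma> t \<tau> \<Longrightarrow> vtotal \<tau> (eval (top_env \<Gamma>) t)"
  using pure_hereditarily_total[of \<Gamma> t \<tau> "top_env \<Gamma>"] hereditarily_total_vtop_and_imp_total
  by (simp add: top_env_def)


section \<open>The approximation preorder\<close>

text \<open>Contexts grow at their end, so terms need not be renamed when passing to a later world.\<close>

primrec approx :: "cnst set \<Rightarrow> ty \<Rightarrow> ty list \<Rightarrow> trm \<Rightarrow> trm \<Rightarrow> bool" where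
  "approx C Ground \<Delta> s t \<longleftrightarrow> has_type C \<Delta> s Ground \<and> has_type C \<Delta> t Ground \<and>
     (vtotal Ground (eval (top_env \<Delta>) s) \<longrightarrow> conv C \<Delta> s t Ground)"
| "approx C (\<sigma> \<rightarrow> \<tau>) \<Delta> s t \<longleftrightarrow> has_type C \<Delta> s (\<sigma> \<rightarrow> \<tau>) \<and> has_type C \<Delta> t (\<sigma> \<rightarrow> \<tau>) \<and>
     (\<forall>\<Delta>' u u'. approx C \<sigma> (\<Delta> @ \<Delta>') u u' \<longrightarrow> approx C \<tau> (\<Delta> @ \<Delta>') (s \<cdot> u) (t \<cdot> u'))"

lemma approx_has_type: "approx C \<tau> \<Delta> s t \<Longrightarrow> has_type C \<Delta> s \<tau> \<and> has_type C \<Delta> t \<tau>"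
  by (cases \<tau>) auto

lemma approx_weaken:
  assumes "approx C \<tau> \<Delta> s t"
  shows "approx C \<tau> (\<Delta> @ \<Delta>') s t"
proof (cases \<tau>)
  case Ground
  have "eval (top_env (\<Delta> @ \<Delta>')) s = eval (top_env \<Delta>) s"
    using approx_has_type[OF assms] by (blast intro: eval_top_env_append)
  then show ?thesis
    using assms unfolding Ground by (auto intro: has_type_weaken conv_weaken)
next
  case (Fun \<sigma> \<tau>)
  then show ?thesis
    using assms by (auto intro: has_type_weaken)
qed

lemma approx_app:
  "approx C (\<sigma> \<rightarrow> \<tau>) \<Delta> s t \<Longrightarrow> approx C \<sigma> \<Delta> u u' \<Longrightarrow> approx C \<tau> \<Delta> (s \<cdot> u) (t \<cdot> u')"
  using append_Nil2[of \<Delta>] by (metis approx.simps(2))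

text \<open>At ground type soundness of the model carries totality from \<open>s'\<close> to
  \<open>s\<close>, and the conversions are chained. At function types both sides are applied to
  related arguments.\<close>

lemma approx_conv:
  assumes "approx C \<tau> \<Delta> s t" "conv C \<Delta> s' s \<tau>" "conv C \<Delta> t t' \<tau>"
  shows "approx C \<tau> \<Delta> s' t'"
  using assms
proof (induction \<tau> arbitrary: \<Delta> s t s' t')
  case Ground
  have "eval (top_env \<Delta>) s' = eval (top_env \<Delta>) s"
    using Ground(2) by (rule eval_conv) simp
  then show ?case
    using Ground conv_has_type[OF Ground(2)] conv_has_type[OF Ground(3)]
    by (auto intro: conv.trans)
next
  case (Fun \<sigma> \<tau>)
  have "approx C \<tau> (\<Delta> @ \<Delta>') (s' \<cdot> u) (t' \<cdot> u')" if u: "approx C \<sigma> (\<Delta> @ \<Delta>') u u'" for \<Delta>' u u'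
  proof (rule Fun.IH(2))
    show "approx C \<tau> (\<Delta> @ \<Delta>') (s \<cdot> u) (t \<cdot> u')"
      using Fun.prems(1) u by simp
    show "conv C (\<Delta> @ \<Delta>') (s' \<cdot> u) (s \<cdot> u) \<tau>" "conv C (\<Delta> @ \<Delta>') (t \<cdot> u') (t' \<cdot> u') \<tau>"
      using approx_has_type[OF u] Fun.prems(2,3) by (auto intro: conv.app conv.refl conv_weaken)
  qed
  then show ?case
    using conv_has_type[OF Fun.prems(2)] conv_has_type[OF Fun.prems(3)] by simp
qed

text \<open>Reification and reflection, by simultaneous induction on the type. To reify at a
  function type, both terms are applied to a fresh variable, which is related to itself by
  reflection because its value is \<open>vtop\<close>; extensionality then removes it. Reflection
  relates convertible terms of value \<open>vtop\<close>, and makes a term of value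
  \<open>vbot\<close> approximate everything of its type.\<close>

lemma approx_reify_reflect:
  "(approx C \<tau> \<Delta> s t \<longrightarrow> vtotal \<tau> (eval (top_env \<Delta>) s) \<longrightarrow> conv C \<Delta> s t \<tau>) \<and>
   (has_type C \<Delta> s \<tau> \<longrightarrow> has_type C \<Delta> t \<tau> \<longrightarrow>
     eval (top_env \<Delta>) s = vtop \<tau> \<and> conv C \<Delta> s t \<tau> \<or> eval (top_env \<Delta>) s = vbot \<tau> \<longrightarrow>
     approx C \<tau> \<Delta> s t)"
proof (induction \<tau> arbitrary: \<Delta> s t)
  case (Fun \<sigma> \<tau>)
  note reify_\<sigma> = Fun.IH(1)[THEN conjunct1, rule_format]
    and reflect_\<sigma> = Fun.IH(1)[THEN conjunct2, rule_format]
    and reify_\<tau> = Fun.IH(2)[THEN conjunct1, rule_format]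
    and reflect_\<tau> = Fun.IH(2)[THEN conjunct2, rule_format]
  show ?case
  proof (intro conjI impI)
    assume st: "approx C (\<sigma> \<rightarrow> \<tau>) \<Delta> s t" and tot: "vtotal (\<sigma> \<rightarrow> \<tau>) (eval (top_env \<Delta>) s)"
    let ?x = "Var (length \<Delta>)" and ?\<Delta> = "\<Delta> @ [\<sigma>]"
    have types: "has_type C \<Delta> s (\<sigma> \<rightarrow> \<tau>)" "has_type C \<Delta> t (\<sigma> \<rightarrow> \<tau>)"
      using approx_has_type[OF st] by auto
    have x: "has_type C ?\<Delta> ?x \<sigma>" and x_top: "eval (top_env ?\<Delta>) ?x = vtop \<sigma>"
      using has_type.Var[of "length \<Delta>" ?\<Delta> C] by (auto simp: top_env_def)
    have "approx C \<sigma> ?\<Delta> ?x ?x"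
      using reflect_\<sigma>[OF x x] x_top conv.refl[OF x] by blast
    then have "approx C \<tau> ?\<Delta> (s \<cdot> ?x) (t \<cdot> ?x)"
      using st by simp
    moreover have "vtotal \<tau> (eval (top_env ?\<Delta>) (s \<cdot> ?x))"
      using tot x_top eval_top_env_append[OF types(1)] by simp
    ultimately have "conv C ?\<Delta> (s \<cdot> ?x) (t \<cdot> ?x) \<tau>"
      by (rule reify_\<tau>)
    then show "conv C \<Delta> s t (\<sigma> \<rightarrow> \<tau>)"
      using types by (rule conv_ext_last)
  next
    assume s: "has_type C \<Delta> s (\<sigma> \<rightarrow> \<tau>)" and t: "has_type C \<Delta> t (\<sigma> \<rightarrow> \<tau>)"
      and st: "eval (top_env \<Delta>) s = vtop (\<sigma> \<rightarrow> \<tau>) \<and> conv C \<Delta> s t (\<sigma> \<rightarrow> \<tau>) \<or>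
        eval (top_env \<Delta>) s = vbot (\<sigma> \<rightarrow> \<tau>)"
    have "approx C \<tau> (\<Delta> @ \<Delta>') (s \<cdot> u) (t \<cdot> u')" if uu': "approx C \<sigma> (\<Delta> @ \<Delta>') u u'" for \<Delta>' u u'
    proof (rule reflect_\<tau>)
      have u: "has_type C (\<Delta> @ \<Delta>') u \<sigma>" and u': "has_type C (\<Delta> @ \<Delta>') u' \<sigma>"
        using approx_has_type[OF uu'] by auto
      then show "has_type C (\<Delta> @ \<Delta>') (s \<cdot> u) \<tau>" "has_type C (\<Delta> @ \<Delta>') (t \<cdot> u') \<tau>"
        using s t by (auto intro: has_type.App has_type_weaken)
      let ?\<eta> = "top_env (\<Delta> @ \<Delta>')"
      have in_vals: "eval ?\<eta> u \<in> vals \<sigma>"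
        using u by (rule eval_in_vals) simp
      from st show "eval ?\<eta> (s \<cdot> u) = vtop \<tau> \<and> conv C (\<Delta> @ \<Delta>') (s \<cdot> u) (t \<cdot> u') \<tau> \<or>
          eval ?\<eta> (s \<cdot> u) = vbot \<tau>"
      proof (elim disjE conjE)
        assume top: "eval (top_env \<Delta>) s = vtop (\<sigma> \<rightarrow> \<tau>)" and conv: "conv C \<Delta> s t (\<sigma> \<rightarrow> \<tau>)"
        have *: "eval ?\<eta> (s \<cdot> u) = (if vtotal \<sigma> (eval ?\<eta> u) then vtop \<tau> else vbot \<tau>)"
          using in_vals top eval_top_env_append[OF s] by simp
        show ?thesis
        \<comment> \<open>\<open>vtop\<close> tests its argument. If \<open>u\<close> is total,
          reification at \<open>\<sigma>\<close> makes \<open>u\<close> and \<open>u'\<close>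
          convertible and the value stays \<open>vtop\<close>; otherwise the value drops to
          \<open>vbot\<close>.\<close>
        proof (cases "vtotal \<sigma> (eval ?\<eta> u)")
          case True
          then have "conv C (\<Delta> @ \<Delta>') u u' \<sigma>"
            using reify_\<sigma> uu' by blast
          then show ?thesis
            using True * conv by (auto intro: conv.app conv_weaken)
        qed (use * in simp)
      qed (use in_vals eval_top_env_append[OF s] in simp)
    qed
    then show "approx C (\<sigma> \<rightarrow> \<tau>) \<Delta> s t"
      using s t by simp
  qed
qed auto

lemmas approx_reify = approx_reify_reflect[THEN conjunct1, rule_format]
  and approx_reflect = approx_reify_reflect[THEN conjunct2, rule_format]

text \<open>Related arguments \<open>a\<close> and \<open>a'\<close> are split as \<open>a\<close>,
  \<open>a\<close>, \<open>a'\<close>: the first comparison uses the pair \<open>a\<close>,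
  \<open>a\<close>, whence the reflexivity assumption. At ground type soundness carries totality
  from \<open>s\<close> to \<open>t\<close>.\<close>

lemma approx_trans:
  assumes refl: "\<And>\<tau> \<Delta> s. has_type C \<Delta> s \<tau> \<Longrightarrow> approx C \<tau> \<Delta> s s"
  shows "approx C \<tau> \<Delta> s t \<Longrightarrow> approx C \<tau> \<Delta> t u \<Longrightarrow> approx C \<tau> \<Delta> s u"
proof (induction \<tau> arbitrary: \<Delta> s t u)
  case Ground
  then show ?case
    using eval_conv[of C \<Delta> s t Ground "top_env \<Delta>"] by (auto intro: conv.trans)
next
  case (Fun \<sigma> \<tau>)
  have "approx C \<tau> (\<Delta> @ \<Delta>') (s \<cdot> a) (u \<cdot> a')" if "approx C \<sigma> (\<Delta> @ \<Delta>') a a'" for \<Delta>' a a'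
    using Fun.IH(2)[of "\<Delta> @ \<Delta>'" "s \<cdot> a" "t \<cdot> a" "u \<cdot> a'"] Fun.prems that
      refl[of "\<Delta> @ \<Delta>'" a \<sigma>] approx_has_type[OF that] by auto
  then show ?case
    using Fun.prems by simp
qed

section \<open>Fundamental lemma of the approximation relation\<close>

definition approx_sub :: "cnst set \<Rightarrow> ty list \<Rightarrow> (nat \<Rightarrow> trm) \<Rightarrow> (nat \<Rightarrow> trm) \<Rightarrow> ty list \<Rightarrow> bool" where
  "approx_sub C \<Delta> \<rho> \<rho>' \<Gamma> \<longleftrightarrow> (\<forall>i<length \<Gamma>. approx C (\<Gamma> ! i) \<Delta> (\<rho> i) (\<rho>' i))"

lemma approx_sub_typed: "approx_sub C \<Delta> \<rho> \<rho>' \<Gamma> \<Longrightarrow> sub_typed C \<Delta> \<rho> \<Gamma> \<and> sub_typed C \<Delta> \<rho>' \<Gamma>"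
  by (auto simp: approx_sub_def sub_typed_def dest: approx_has_type)

lemma approx_sub_case_nat:
  "approx C \<sigma> (\<Delta> @ \<Delta>') u u' \<Longrightarrow> approx_sub C \<Delta> \<rho> \<rho>' \<Gamma> \<Longrightarrow>
    approx_sub C (\<Delta> @ \<Delta>') (case_nat u \<rho>) (case_nat u' \<rho>') (\<sigma> # \<Gamma>)"
  by (auto simp: approx_sub_def nth_Cons intro: approx_weaken split: nat.split)

lemma approx_sub_Var: "approx_sub C \<Gamma> Var Var \<Gamma>"
  unfolding approx_sub_def
  by (auto intro!: approx_reflect has_type.Var conv.refl simp: top_env_def)

lemma approx_Lam:
  assumes "has_type C (\<sigma> # \<Delta>) (sub (\<lambda>c. lift 0 (\<delta> c)) (up \<rho>) s) \<tau>"
    and "has_type C (\<sigma> # \<Delta>) (sub (\<lambda>c. lift 0 (\<delta>' c)) (up \<rho>') t) \<tau>"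
    and "\<And>\<Delta>' u u'. approx C \<sigma> (\<Delta> @ \<Delta>') u u' \<Longrightarrow>
      approx C \<tau> (\<Delta> @ \<Delta>') (sub \<delta> (case_nat u \<rho>) s) (sub \<delta>' (case_nat u' \<rho>') t)"
  shows "approx C (\<sigma> \<rightarrow> \<tau>) \<Delta> (sub \<delta> \<rho> (Lam \<sigma> s)) (sub \<delta>' \<rho>' (Lam \<sigma> t))"
proof -
  have "approx C \<tau> (\<Delta> @ \<Delta>') (sub \<delta> \<rho> (Lam \<sigma> s) \<cdot> u) (sub \<delta>' \<rho>' (Lam \<sigma> t) \<cdot> u')"
    if u: "approx C \<sigma> (\<Delta> @ \<Delta>') u u'" for \<Delta>' u u'
  proof (rule approx_conv[OF assms(3)[OF u]])
    have "has_type C (\<sigma> # \<Delta> @ \<Delta>') (sub (\<lambda>c. lift 0 (\<delta> c)) (up \<rho>) s) \<tau>"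
      "has_type C (\<sigma> # \<Delta> @ \<Delta>') (sub (\<lambda>c. lift 0 (\<delta>' c)) (up \<rho>') t) \<tau>"
      using assms(1,2)[THEN has_type_weaken, of C \<Delta>'] by auto
    then show "conv C (\<Delta> @ \<Delta>') (sub \<delta> \<rho> (Lam \<sigma> s) \<cdot> u) (sub \<delta> (case_nat u \<rho>) s) \<tau>"
      "conv C (\<Delta> @ \<Delta>') (sub \<delta>' (case_nat u' \<rho>') t) (sub \<delta>' \<rho>' (Lam \<sigma> t) \<cdot> u') \<tau>"
      using approx_has_type[OF u] by (blast intro: conv_sub_beta conv.sym)+
  qed
  then show ?thesis
    using assms(1,2) by (auto intro: has_type.Lam)
qed

text \<open>Two interpretations of the constants are compared at once. They may be the constants
  themselves, two unrolling depths, or an unrolling on the left and \<open>Y\<close> itself on the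
  right.\<close>

lemma approx_fundamental:
  assumes "has_type C' \<Gamma> t \<tau>" "approx_sub C \<Delta> \<rho> \<rho>' \<Gamma>"
    and \<delta>: "\<And>c \<Delta>. c \<in> C' \<Longrightarrow> approx C (const_ty c) \<Delta> (\<delta> c) (\<delta>' c)"
  shows "approx C \<tau> \<Delta> (sub \<delta> \<rho> t) (sub \<delta>' \<rho>' t)"
  using assms(1,2)
proof (induction arbitrary: \<Delta> \<rho> \<rho>' rule: has_type.induct)
  case (Var i \<Gamma>)
  then show ?case
    by (simp add: approx_sub_def)
next
  case (Const c \<Gamma>)
  then show ?case
    by (simp add: \<delta>)
next
  case (App \<Gamma> s \<sigma> \<tau> t)
  show ?case
    unfolding sub.simps by (rule approx_app; rule App.IH; fact App.prems)
next
  case (Lam \<sigma> \<Gamma> t \<tau>)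
  note \<delta>_type = \<delta>[THEN approx_has_type]
  show ?case
  proof (rule approx_Lam)
    show "has_type C (\<sigma> # \<Delta>) (sub (\<lambda>c. lift 0 (\<delta> c)) (up \<rho>) t) \<tau>"
      "has_type C (\<sigma> # \<Delta>) (sub (\<lambda>c. lift 0 (\<delta>' c)) (up \<rho>') t) \<tau>"
      using approx_sub_typed[OF Lam.prems] \<delta>_type
      by (blast intro: has_type_sub[OF Lam.hyps] sub_typed_up has_type_lift_0)+
    show "approx C \<tau> (\<Delta> @ \<Delta>') (sub \<delta> (case_nat u \<rho>) t) (sub \<delta>' (case_nat u' \<rho>') t)"
      if "approx C \<sigma> (\<Delta> @ \<Delta>') u u'" for \<Delta>' u u'
      using that Lam.prems by (intro Lam.IH approx_sub_case_nat)
  qed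
qed

text \<open>\<open>Omega\<close> has the bottom value, so reflection relates it to itself.\<close>

lemma approx_refl_Omega:
  assumes "has_type lambda_Omega \<Delta> s \<tau>"
  shows "approx lambda_Omega \<tau> \<Delta> s s"
proof -
  have "approx lambda_Omega (const_ty c) \<Delta> (Const c) (Const c)" if "c \<in> lambda_Omega" for c \<Delta>
    using that has_type.Const[OF that, of \<Delta>]
    by (intro approx_reflect) (auto simp: lambda_Omega_def)
  from approx_fundamental[OF assms approx_sub_Var this] show ?thesis
    by simp
qed


section \<open>Finite approximations of the fixed point operators\<close>

primrec bot_trm :: "ty \<Rightarrow> trm" where
  "bot_trm Ground = Const Omega"
| "bot_trm (\<sigma> \<rightarrow> \<tau>) = Lam \<sigma> (bot_trm \<tau>)"

fun unroll :: "nat \<Rightarrow> cnst \<Rightarrow> trm" where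
  "unroll n Omega = Const Omega"
| "unroll n (Y \<sigma>) = Lam (\<sigma> \<rightarrow> \<sigma>) (((\<cdot>) (Var 0) ^^ n) (bot_trm \<sigma>))"

lemma has_type_bot_trm: "Omega \<in> C \<Longrightarrow> has_type C \<Gamma> (bot_trm \<sigma>) \<sigma>"
  using has_type.Const[of Omega C] by (induction \<sigma> arbitrary: \<Gamma>) (auto intro: has_type.Lam)

lemma has_type_iterate:
  "has_type C \<Gamma> f (\<sigma> \<rightarrow> \<sigma>) \<Longrightarrow> has_type C \<Gamma> t \<sigma> \<Longrightarrow> has_type C \<Gamma> (((\<cdot>) f ^^ n) t) \<sigma>"
  by (induction n) (auto intro: has_type.App)

lemma has_type_unroll: "Omega \<in> C \<Longrightarrow> has_type C \<Gamma> (unroll n c) (const_ty c)"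
  using has_type.Const[of Omega C]
  by (cases c) (auto intro!: has_type.Lam has_type_iterate has_type_Var_0 has_type_bot_trm)

lemma subst_bot_trm: "subst k u (bot_trm \<sigma>) = bot_trm \<sigma>"
  by (induction \<sigma> arbitrary: k u) auto

lemma subst_iterate: "subst 0 f (((\<cdot>) (Var 0) ^^ n) (bot_trm \<sigma>)) = ((\<cdot>) f ^^ n) (bot_trm \<sigma>)"
  by (induction n) (auto simp: subst_bot_trm)

lemma conv_unroll:
  assumes "Omega \<in> C" "has_type C \<Gamma> f (\<sigma> \<rightarrow> \<sigma>)"
  shows "conv C \<Gamma> (unroll n (Y \<sigma>) \<cdot> f) (((\<cdot>) f ^^ n) (bot_trm \<sigma>)) \<sigma>"
proof -
  have "has_type C ((\<sigma> \<rightarrow> \<sigma>) # \<Gamma>) (((\<cdot>) (Var 0) ^^ n) (bot_trm \<sigma>)) \<sigma>"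
    using assms by (intro has_type_iterate has_type_Var_0 has_type_bot_trm)
  from conv.beta[OF this assms(2)] show ?thesis
    by (simp add: subst_iterate)
qed

lemma conv_unroll_Suc:
  assumes "Omega \<in> C" "has_type C \<Gamma> f (\<sigma> \<rightarrow> \<sigma>)"
  shows "conv C \<Gamma> (f \<cdot> (unroll n (Y \<sigma>) \<cdot> f)) (unroll (Suc n) (Y \<sigma>) \<cdot> f) \<sigma>"
  using conv.trans[OF conv.app[OF conv.refl[OF assms(2)] conv_unroll[OF assms, of n]]]
    conv_unroll[OF assms, of "Suc n", THEN conv.sym] by (simp del: unroll.simps)

lemma eval_bot_trm [simp]: "eval \<eta> (bot_trm \<sigma>) = vbot \<sigma>"
  by (induction \<sigma> arbitrary: \<eta>) auto

lemma eval_iterate: "eval \<eta> (((\<cdot>) f ^^ n) t) = (ap (eval \<eta> f) ^^ n) (eval \<eta> t)"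
  by (induction n) auto

lemma eval_unroll:
  assumes "\<And>\<sigma>. c = Y \<sigma> \<Longrightarrow> card (vals \<sigma>) \<le> n"
  shows "eval \<eta> (unroll n c) = cval c"
  using assms by (cases c) (auto simp: eval_iterate simp del: vals.simps intro!: tab_cong iterate_stable)

text \<open>Finitely many constants occur in \<open>t\<close>, so the sum of the sizes of their
  domains bounds every number of iterations required.\<close>

lemma eventually_eval_unroll: "\<exists>n. \<forall>c\<in>consts_of t. \<forall>\<eta>. eval \<eta> (unroll n c) = cval c"
proof -
  define h where "h c = (case c of Omega \<Rightarrow> 0 | Y \<sigma> \<Rightarrow> card (vals \<sigma>))" for c
  have "h c \<le> sum h (consts_of t)" if "c \<in> consts_of t" for c
    using that finite_consts by (intro member_le_sum) auto
  then have "\<forall>c\<in>consts_of t. \<forall>\<eta>. eval \<eta> (unroll (sum h (consts_of t)) c) = cval c"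
    by (intro ballI allI eval_unroll) (force simp: h_def)
  then show ?thesis ..
qed

text \<open>The first \<open>n\<close> applications on the right are matched with those on the left;
  then the bottom term approximates whatever remains. So \<open>t\<close> is arbitrary and the right
  side may iterate further.\<close>

lemma approx_iterate:
  assumes "Omega \<in> C" "approx C (\<sigma> \<rightarrow> \<sigma>) \<Delta> f f'" "has_type C \<Delta> t \<sigma>" "n \<le> n'"
  shows "approx C \<sigma> \<Delta> (((\<cdot>) f ^^ n) (bot_trm \<sigma>)) (((\<cdot>) f' ^^ n') t)"
  using assms(4)
proof (induction n arbitrary: n')
  case 0
  show ?case
    using approx_has_type[OF assms(2)] assms(1,3)
    by (intro approx_reflect) (auto intro: has_type_bot_trm has_type_iterate)
next
  case (Suc n)
  then obtain k where "n' = Suc k" "n \<le> k"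
    by (cases n') auto
  then show ?case
    using approx_app[OF assms(2) Suc.IH] by simp
qed

lemma approx_FunI:
  assumes "has_type C \<Delta> s (\<sigma> \<rightarrow> \<tau>)" "has_type C \<Delta> t (\<sigma> \<rightarrow> \<tau>)"
    and "\<And>\<Delta>' u u'. approx C \<sigma> (\<Delta> @ \<Delta>') u u' \<Longrightarrow> approx C \<tau> (\<Delta> @ \<Delta>') (s \<cdot> u) (t \<cdot> u')"
  shows "approx C (\<sigma> \<rightarrow> \<tau>) \<Delta> s t"
  using assms by simp

lemma approx_unroll_app:
  assumes "Omega \<in> C" "approx C (\<sigma> \<rightarrow> \<sigma>) \<Delta> f f'" "n \<le> n'"
  shows "approx C \<sigma> \<Delta> (unroll n (Y \<sigma>) \<cdot> f) (unroll n' (Y \<sigma>) \<cdot> f')"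
  using approx_has_type[OF assms(2)] assms(1)
  by (intro approx_conv[OF approx_iterate[OF assms(1,2) has_type_bot_trm assms(3)]])
    (auto intro: conv_unroll conv.sym simp del: unroll.simps)

lemma approx_unroll_mono:
  assumes "n \<le> n'" "c \<in> lambda_Y"
  shows "approx lambda_Omega (const_ty c) \<Delta> (unroll n c) (unroll n' c)"
proof -
  obtain \<sigma> where c: "c = Y \<sigma>"
    using assms(2) by (auto simp: lambda_Y_def)
  have Omega: "Omega \<in> lambda_Omega"
    by (simp add: lambda_Omega_def)
  show ?thesis
    unfolding c const_ty.simps using has_type_unroll[OF Omega, of _ _ "Y \<sigma>"] assms(1)
    by (intro approx_FunI approx_unroll_app Omega) (auto simp del: unroll.simps)
qed

lemma conv_iterate_Y:
  assumes "Y \<sigma> \<in> C" "has_type C \<Gamma> f (\<sigma> \<rightarrow> \<sigma>)"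
  shows "conv C \<Gamma> (((\<cdot>) f ^^ n) (Const (Y \<sigma>) \<cdot> f)) (Const (Y \<sigma>) \<cdot> f) \<sigma>"
proof (induction n)
  case 0
  show ?case
    using conv.Y[OF assms] conv_has_type by (auto intro: conv.refl)
next
  case (Suc n)
  show ?case
    using conv.trans[OF conv.app[OF conv.refl[OF assms(2)] Suc] conv.Y[OF assms]] by simp
qed

text \<open>The fixed point rule turns \<open>Const (Y \<sigma>) \<cdot> f'\<close> into its
  \<open>n\<close>-fold application of \<open>f'\<close>, to which \<open>approx_iterate\<close>
  applies. The comparison involves both \<open>Omega\<close> and \<open>Y\<close>, so it lives in
  the calculus with all constants.\<close>

lemma approx_unroll_Y:
  assumes "c \<in> lambda_Y"
  shows "approx UNIV (const_ty c) \<Delta> (unroll n c) (Const c)"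
proof -
  obtain \<sigma> where c: "c = Y \<sigma>"
    using assms by (auto simp: lambda_Y_def)
  have Y: "has_type UNIV \<Delta>' (Const (Y \<sigma>)) ((\<sigma> \<rightarrow> \<sigma>) \<rightarrow> \<sigma>)" for \<Delta>'
    using has_type.Const[of "Y \<sigma>" UNIV \<Delta>'] by simp
  have "approx UNIV \<sigma> \<Delta>' (unroll n (Y \<sigma>) \<cdot> f) (Const (Y \<sigma>) \<cdot> f')"
    if ff': "approx UNIV (\<sigma> \<rightarrow> \<sigma>) \<Delta>' f f'" for \<Delta>' f f'
  proof (rule approx_conv)
    have f: "has_type UNIV \<Delta>' f (\<sigma> \<rightarrow> \<sigma>)" and f': "has_type UNIV \<Delta>' f' (\<sigma> \<rightarrow> \<sigma>)"
      using approx_has_type[OF ff'] by auto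
    show "approx UNIV \<sigma> \<Delta>' (((\<cdot>) f ^^ n) (bot_trm \<sigma>)) (((\<cdot>) f' ^^ n) (Const (Y \<sigma>) \<cdot> f'))"
      using ff' Y f' by (intro approx_iterate) (auto intro: has_type.App)
    show "conv UNIV \<Delta>' (unroll n (Y \<sigma>) \<cdot> f) (((\<cdot>) f ^^ n) (bot_trm \<sigma>)) \<sigma>"
      using f by (intro conv_unroll) auto
    show "conv UNIV \<Delta>' (((\<cdot>) f' ^^ n) (Const (Y \<sigma>) \<cdot> f')) (Const (Y \<sigma>) \<cdot> f') \<sigma>"
      using f' by (intro conv_iterate_Y) auto
  qed
  then show ?thesis
    unfolding c const_ty.simps using has_type_unroll[of UNIV _ _ "Y \<sigma>"] Y
    by (intro approx_FunI) (auto simp del: unroll.simps)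
qed


section \<open>Conversion in the \<open>Y\<close> calculus seen through unrollings\<close>

lemma has_type_sub_unroll:
  "has_type lambda_Y \<Gamma> t \<tau> \<Longrightarrow> sub_typed lambda_Omega \<Delta> \<rho> \<Gamma> \<Longrightarrow>
    has_type lambda_Omega \<Delta> (sub (unroll n) \<rho> t) \<tau>"
  by (erule has_type_sub) (auto simp: lambda_Omega_def intro!: has_type_unroll)

lemma lift_unroll [simp]: "lift k (unroll n c) = unroll n c"
  using has_type_unroll[of UNIV "[]" n c] by (auto intro: lift_closed)

text \<open>The two sides of the fixed point rule unroll to iterates of different depths, so
  unrolling to equal depth does not turn it into a conversion. The slack \<open>k\<close> lets the
  right side unroll further; related substitutions are included to pass under binders.\<close>

definition eventually_approx :: "nat \<Rightarrow> ty list \<Rightarrow> ty \<Rightarrow> trm \<Rightarrow> trm \<Rightarrow> bool" where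
  "eventually_approx k \<Gamma> \<tau> s t \<longleftrightarrow>
     (\<forall>n n' \<Delta> \<rho> \<rho>'. n + k \<le> n' \<longrightarrow> approx_sub lambda_Omega \<Delta> \<rho> \<rho>' \<Gamma> \<longrightarrow>
        approx lambda_Omega \<tau> \<Delta> (sub (unroll n) \<rho> s) (sub (unroll n') \<rho>' t))"

lemma eventually_approx_mono:
  "eventually_approx k \<Gamma> \<tau> s t \<Longrightarrow> k \<le> k' \<Longrightarrow> eventually_approx k' \<Gamma> \<tau> s t"
  unfolding eventually_approx_def by (meson add_left_mono order_trans)

lemma eventually_approx_refl:
  assumes "has_type lambda_Y \<Gamma> t \<tau>"
  shows "eventually_approx 0 \<Gamma> \<tau> t t"
  unfolding eventually_approx_def using approx_fundamental[OF assms] approx_unroll_mono by simp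

lemma eventually_approx_trans:
  assumes "eventually_approx k \<Gamma> \<tau> s t" "eventually_approx k' \<Gamma> \<tau> t u"
  shows "eventually_approx (k + k') \<Gamma> \<tau> s u"
  unfolding eventually_approx_def
proof (intro allI impI)
  fix n n' \<Delta> \<rho> \<rho>'
  assume n': "n + (k + k') \<le> n'" and \<rho>: "approx_sub lambda_Omega \<Delta> \<rho> \<rho>' \<Gamma>"
  \<comment> \<open>The middle term is unrolled to depth \<open>n + k\<close> under
    \<open>\<rho>'\<close>; the second comparison therefore needs \<open>\<rho>'\<close> related to
    itself.\<close>
  have "approx_sub lambda_Omega \<Delta> \<rho>' \<rho>' \<Gamma>"
    using approx_sub_typed[OF \<rho>] by (auto simp: approx_sub_def sub_typed_def intro: approx_refl_Omega)
  then have "approx lambda_Omega \<tau> \<Delta> (sub (unroll (n + k)) \<rho>' t) (sub (unroll n') \<rho>' u)"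
    using assms(2) n' unfolding eventually_approx_def by (simp add: add.assoc)
  moreover have "approx lambda_Omega \<tau> \<Delta> (sub (unroll n) \<rho> s) (sub (unroll (n + k)) \<rho>' t)"
    using assms(1) \<rho> unfolding eventually_approx_def by simp
  ultimately show "approx lambda_Omega \<tau> \<Delta> (sub (unroll n) \<rho> s) (sub (unroll n') \<rho>' u)"
    using approx_trans[OF approx_refl_Omega] by blast
qed

lemma eventually_approx_app:
  "eventually_approx k \<Gamma> (\<sigma> \<rightarrow> \<tau>) s s' \<Longrightarrow> eventually_approx k \<Gamma> \<sigma> t t' \<Longrightarrow>
    eventually_approx k \<Gamma> \<tau> (s \<cdot> t) (s' \<cdot> t')"
  unfolding eventually_approx_def sub.simps
  by (intro allI impI, rule approx_app) (erule allE impE | assumption)+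

lemma eventually_approx_lam:
  assumes t: "has_type lambda_Y (\<sigma> # \<Gamma>) t \<tau>" and t': "has_type lambda_Y (\<sigma> # \<Gamma>) t' \<tau>"
    and tt': "eventually_approx k (\<sigma> # \<Gamma>) \<tau> t t'"
  shows "eventually_approx k \<Gamma> (\<sigma> \<rightarrow> \<tau>) (Lam \<sigma> t) (Lam \<sigma> t')"
  unfolding eventually_approx_def
proof (intro allI impI)
  fix n n' \<Delta> \<rho> \<rho>'
  assume n': "n + k \<le> n'" and \<rho>: "approx_sub lambda_Omega \<Delta> \<rho> \<rho>' \<Gamma>"
  show "approx lambda_Omega (\<sigma> \<rightarrow> \<tau>) \<Delta> (sub (unroll n) \<rho> (Lam \<sigma> t)) (sub (unroll n') \<rho>' (Lam \<sigma> t'))"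
  proof (rule approx_Lam)
    show "has_type lambda_Omega (\<sigma> # \<Delta>) (sub (\<lambda>c. lift 0 (unroll n c)) (up \<rho>) t) \<tau>"
      "has_type lambda_Omega (\<sigma> # \<Delta>) (sub (\<lambda>c. lift 0 (unroll n' c)) (up \<rho>') t') \<tau>"
      using approx_sub_typed[OF \<rho>] t t'
      by (auto intro!: sub_typed_up has_type_sub_unroll[of "\<sigma> # \<Gamma>"])
    show "approx lambda_Omega \<tau> (\<Delta> @ \<Delta>') (sub (unroll n) (case_nat u \<rho>) t)
        (sub (unroll n') (case_nat u' \<rho>') t')"
      if "approx lambda_Omega \<sigma> (\<Delta> @ \<Delta>') u u'" for \<Delta>' u u'
      using tt' n' approx_sub_case_nat[OF that \<rho>] unfolding eventually_approx_def by blast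
  qed
qed

text \<open>For rules that commute with unrolling, such as beta and eta: \<open>s\<close> is
  compared with itself at both depths, and one side is then exchanged for \<open>t\<close> by
  conversion. No slack arises.\<close>

lemma eventually_approx_of_conv:
  assumes "has_type lambda_Y \<Gamma> s \<tau>"
    and conv: "\<And>n \<Delta> \<rho>. sub_typed lambda_Omega \<Delta> \<rho> \<Gamma> \<Longrightarrow>
      conv lambda_Omega \<Delta> (sub (unroll n) \<rho> s) (sub (unroll n) \<rho> t) \<tau>"
  shows "eventually_approx 0 \<Gamma> \<tau> s t \<and> eventually_approx 0 \<Gamma> \<tau> t s"
proof -
  have "approx lambda_Omega \<tau> \<Delta> (sub (unroll n) \<rho> s) (sub (unroll n') \<rho>' t) \<and>
      approx lambda_Omega \<tau> \<Delta> (sub (unroll n) \<rho> t) (sub (unroll n') \<rho>' s)"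
    if "n \<le> n'" and \<rho>: "approx_sub lambda_Omega \<Delta> \<rho> \<rho>' \<Gamma>" for n n' \<Delta> \<rho> \<rho>'
  proof -
    have ss: "approx lambda_Omega \<tau> \<Delta> (sub (unroll n) \<rho> s) (sub (unroll n') \<rho>' s)"
      using eventually_approx_refl[OF assms(1)] that unfolding eventually_approx_def by simp
    have types: "sub_typed lambda_Omega \<Delta> \<rho> \<Gamma>" "sub_typed lambda_Omega \<Delta> \<rho>' \<Gamma>"
      using approx_sub_typed[OF \<rho>] by auto
    have "conv lambda_Omega \<Delta> (sub (unroll n) \<rho> s) (sub (unroll n) \<rho> s) \<tau>"
      "conv lambda_Omega \<Delta> (sub (unroll n') \<rho>' s) (sub (unroll n') \<rho>' s) \<tau>"
      using approx_has_type[OF ss] by (auto intro: conv.refl)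
    then show ?thesis
      using approx_conv[OF ss] conv[OF types(1), of n] conv[OF types(2), of n'] conv.sym by blast
  qed
  then show ?thesis
    unfolding eventually_approx_def by simp
qed

text \<open>Applying \<open>f\<close> once to the unrolling of depth \<open>n\<close> gives the one
  of depth \<open>Suc n\<close>, so a slack of one suffices in both directions.\<close>

lemma eventually_approx_Y:
  assumes f: "has_type lambda_Y \<Gamma> f (\<sigma> \<rightarrow> \<sigma>)"
  shows "eventually_approx 1 \<Gamma> \<sigma> (f \<cdot> (Const (Y \<sigma>) \<cdot> f)) (Const (Y \<sigma>) \<cdot> f) \<and>
    eventually_approx 1 \<Gamma> \<sigma> (Const (Y \<sigma>) \<cdot> f) (f \<cdot> (Const (Y \<sigma>) \<cdot> f))"
proof -
  let ?app = "\<lambda>n f. unroll n (Y \<sigma>) \<cdot> f"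
  have Omega: "Omega \<in> lambda_Omega"
    by (simp add: lambda_Omega_def)
  have "approx lambda_Omega \<sigma> \<Delta> (g \<cdot> ?app n g) (?app n' g') \<and>
      approx lambda_Omega \<sigma> \<Delta> (?app n g) (g' \<cdot> ?app n' g')"
    if "Suc n \<le> n'" and gg': "approx lambda_Omega (\<sigma> \<rightarrow> \<sigma>) \<Delta> g g'" for n n' \<Delta> g g'
  proof
    have g: "has_type lambda_Omega \<Delta> g (\<sigma> \<rightarrow> \<sigma>)" and g': "has_type lambda_Omega \<Delta> g' (\<sigma> \<rightarrow> \<sigma>)"
      using approx_has_type[OF gg'] by auto
    obtain k where k: "n' = Suc k" "n \<le> k"
      using \<open>Suc n \<le> n'\<close> by (cases n') auto
    have 1: "approx lambda_Omega \<sigma> \<Delta> (g \<cdot> ?app n g) (g' \<cdot> ?app k g')"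
      by (intro approx_app[OF gg'] approx_unroll_app[OF Omega gg'] k)
    show "approx lambda_Omega \<sigma> \<Delta> (g \<cdot> ?app n g) (?app n' g')"
      using approx_conv[OF 1 conv.refl conv_unroll_Suc[OF Omega g']] approx_has_type[OF 1] k
      by blast
    have 2: "approx lambda_Omega \<sigma> \<Delta> (?app n g) (?app (Suc n') g')"
      using \<open>Suc n \<le> n'\<close> by (intro approx_unroll_app[OF Omega gg']) simp
    show "approx lambda_Omega \<sigma> \<Delta> (?app n g) (g' \<cdot> ?app n' g')"
      using approx_conv[OF 2 conv.refl conv.sym[OF conv_unroll_Suc[OF Omega g']]]
        approx_has_type[OF 2] by blast
  qed
  then show ?thesis
    using eventually_approx_refl[OF f] unfolding eventually_approx_def
    by (simp del: unroll.simps approx.simps)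
qed

text \<open>Both directions are carried along to handle the symmetry rule. Slacks add up along
  transitivity, so \<open>k\<close> depends on the derivation.\<close>

lemma conv_lambda_Y_eventually_approx:
  "conv lambda_Y \<Gamma> s t \<tau> \<Longrightarrow> \<exists>k. eventually_approx k \<Gamma> \<tau> s t \<and> eventually_approx k \<Gamma> \<tau> t s"
proof (induction rule: conv.induct)
  case (refl \<Gamma> t \<tau>)
  then show ?case
    using eventually_approx_refl by blast
next
  case (sym \<Gamma> s t \<tau>)
  then show ?case
    by blast
next
  case (trans \<Gamma> s t \<tau> u)
  then obtain k k' where "eventually_approx k \<Gamma> \<tau> s t" "eventually_approx k \<Gamma> \<tau> t s"
    "eventually_approx k' \<Gamma> \<tau> t u" "eventually_approx k' \<Gamma> \<tau> u t"
    by blast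
  then have "eventually_approx (k + k') \<Gamma> \<tau> s u" "eventually_approx (k + k') \<Gamma> \<tau> u s"
    using eventually_approx_trans[of k \<Gamma> \<tau> s t k' u] eventually_approx_trans[of k' \<Gamma> \<tau> u t k s]
    by (auto simp: add.commute)
  then show ?case
    by blast
next
  case (app \<Gamma> s s' \<sigma> \<tau> t t')
  then obtain k k' where "eventually_approx k \<Gamma> (\<sigma> \<rightarrow> \<tau>) s s'" "eventually_approx k \<Gamma> (\<sigma> \<rightarrow> \<tau>) s' s"
    "eventually_approx k' \<Gamma> \<sigma> t t'" "eventually_approx k' \<Gamma> \<sigma> t' t"
    by blast
  then show ?case
    using eventually_approx_mono[of k _ _ _ _ "k + k'"] eventually_approx_mono[of k' _ _ _ _ "k + k'"]
    by (meson eventually_approx_app le_add1 le_add2)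
next
  case (lam \<sigma> \<Gamma> t t' \<tau>)
  then show ?case
    using conv_has_type[OF lam.hyps] by (blast intro: eventually_approx_lam)
next
  case (beta \<sigma> \<Gamma> s \<tau> t)
  have "eventually_approx 0 \<Gamma> \<tau> (Lam \<sigma> s \<cdot> t) (subst 0 t s) \<and>
      eventually_approx 0 \<Gamma> \<tau> (subst 0 t s) (Lam \<sigma> s \<cdot> t)"
  proof (rule eventually_approx_of_conv)
    show "has_type lambda_Y \<Gamma> (Lam \<sigma> s \<cdot> t) \<tau>"
      using beta by (auto intro: has_type.intros)
    fix n \<Delta> \<rho>
    assume \<rho>: "sub_typed lambda_Omega \<Delta> \<rho> \<Gamma>"
    have "has_type lambda_Omega (\<sigma> # \<Delta>) (sub (\<lambda>c. lift 0 (unroll n c)) (up \<rho>) s) \<tau>"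
      using has_type_sub_unroll[OF beta(1) sub_typed_up[OF \<rho>]] by simp
    then have "conv lambda_Omega \<Delta> (sub (unroll n) \<rho> (Lam \<sigma> s) \<cdot> sub (unroll n) \<rho> t)
        (sub (unroll n) (case_nat (sub (unroll n) \<rho> t) \<rho>) s) \<tau>"
      by (rule conv_sub_beta[OF _ has_type_sub_unroll[OF beta(2) \<rho>]])
    then show "conv lambda_Omega \<Delta> (sub (unroll n) \<rho> (Lam \<sigma> s \<cdot> t)) (sub (unroll n) \<rho> (subst 0 t s)) \<tau>"
      by (simp add: sub_subst_0)
  qed
  then show ?case
    by blast
next
  case (eta \<Gamma> t \<sigma> \<tau>)
  have "eventually_approx 0 \<Gamma> (\<sigma> \<rightarrow> \<tau>) (Lam \<sigma> (lift 0 t \<cdot> Var 0)) t \<and>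
      eventually_approx 0 \<Gamma> (\<sigma> \<rightarrow> \<tau>) t (Lam \<sigma> (lift 0 t \<cdot> Var 0))"
  proof (rule eventually_approx_of_conv)
    show "has_type lambda_Y \<Gamma> (Lam \<sigma> (lift 0 t \<cdot> Var 0)) (\<sigma> \<rightarrow> \<tau>)"
      using conv_has_type[OF conv.eta[OF eta]] by blast
    fix n \<Delta> \<rho>
    assume \<rho>: "sub_typed lambda_Omega \<Delta> \<rho> \<Gamma>"
    have "sub (unroll n) \<rho> (Lam \<sigma> (lift 0 t \<cdot> Var 0)) = Lam \<sigma> (lift 0 (sub (unroll n) \<rho> t) \<cdot> Var 0)"
      using sub_up_lift[of "unroll n" \<rho> t] by (simp del: sub_up_lift)
    then show "conv lambda_Omega \<Delta> (sub (unroll n) \<rho> (Lam \<sigma> (lift 0 t \<cdot> Var 0))) (sub (unroll n) \<rho> t) (\<sigma> \<rightarrow> \<tau>)"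
      using conv.eta[OF has_type_sub_unroll[OF eta \<rho>]] by simp
  qed
  then show ?case
    by blast
next
  case (Y \<sigma> \<Gamma> f)
  then show ?case
    using eventually_approx_Y by blast
qed

lemma provably_equal_unroll_iff:
  assumes A: "has_type lambda_Y [] A \<tau>" and t: "has_type {} [] t \<tau>"
    and n: "\<forall>c\<in>consts_of A. \<forall>\<eta>. eval \<eta> (unroll n c) = cval c"
  shows "provably_equal lambda_Y A t \<longleftrightarrow> provably_equal lambda_Omega (sub (unroll n) Var A) t"
proof
  let ?A = "sub (unroll n) Var A"
  have A': "has_type lambda_Omega [] ?A \<tau>"
    using A by (rule has_type_sub_unroll) (simp add: sub_typed_def)
  have sub_t: "sub \<delta> \<rho> t = t" for \<delta> \<rho>
    using t by (rule sub_ident) auto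
  have total_t: "vtotal \<tau> (eval (top_env \<Gamma>) t)" for \<Gamma>
    using total_pure[OF has_type_closed[OF t]] .
  {
    assume "provably_equal lambda_Y A t"
    then obtain \<Gamma> \<tau>' where conv: "conv lambda_Y \<Gamma> A t \<tau>'"
      by (auto simp: provably_equal_def)
    then have "\<tau>' = \<tau>"
      using conv_has_type has_type_unique has_type_closed[OF A] by blast
    then obtain k where "eventually_approx k \<Gamma> \<tau> A t"
      using conv_lambda_Y_eventually_approx[OF conv] by blast
    then have "approx lambda_Omega \<tau> \<Gamma> ?A (sub (unroll (n + k)) Var t)"
      using approx_sub_Var unfolding eventually_approx_def by blast
    \<comment> \<open>As the depth \<open>n\<close> is exact for the constants of \<open>A\<close>,
      \<open>?A\<close> has the value of \<open>A\<close> and hence that of \<open>t\<close>, which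
      is total. This makes the approximation reifiable, whatever the slack \<open>k\<close>.\<close>
    moreover have "eval (top_env \<Gamma>) ?A = eval (top_env \<Gamma>) t"
      using n eval_conv[OF conv, of "top_env \<Gamma>"] by (simp add: eval_sub)
    ultimately have "conv lambda_Omega \<Gamma> ?A t \<tau>"
      using approx_reify[of lambda_Omega \<tau> \<Gamma> ?A t] total_t by (simp add: sub_t)
    then show "provably_equal lambda_Omega ?A t"
      by (auto simp: provably_equal_def)
  next
    assume "provably_equal lambda_Omega ?A t"
    then obtain \<Gamma> \<tau>' where conv: "conv lambda_Omega \<Gamma> ?A t \<tau>'"
      by (auto simp: provably_equal_def)
    then have \<tau>': "\<tau>' = \<tau>"
      using conv_has_type has_type_unique has_type_closed[OF A'] by blast
    \<comment> \<open>Conversely, \<open>?A\<close> approximates \<open>A\<close> and is total,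
      being convertible to the pure term \<open>t\<close>; reification then makes \<open>?A\<close>
      and \<open>A\<close> convertible.\<close>
    have "approx UNIV \<tau> \<Gamma> ?A (sub Const Var A)"
      using has_type_closed[OF A] approx_sub_Var approx_unroll_Y by (rule approx_fundamental)
    moreover have "vtotal \<tau> (eval (top_env \<Gamma>) ?A)"
      using eval_conv[OF conv, of "top_env \<Gamma>"] total_t by simp
    ultimately have "conv UNIV \<Gamma> ?A A \<tau>"
      using approx_reify by simp
    moreover have "conv UNIV \<Gamma> ?A t \<tau>"
      using conv_weaken[OF conv, of UNIV "[]"] \<tau>' by simp
    ultimately have At: "conv UNIV \<Gamma> A t \<tau>"
      by (blast intro: conv.sym conv.trans)
    \<comment> \<open>The conversion may pass through terms containing \<open>Omega\<close>.
      Replacing it by the fixed point of the identity on \<open>Ground\<close> brings the derivation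
      back into the \<open>Y\<close> calculus.\<close>
    let ?\<delta> = "\<lambda>c. if c = Omega then Const (Y Ground) \<cdot> Lam Ground (Var 0) else Const c"
    have const: "has_type lambda_Y \<Gamma> (Const (Y \<sigma>)) ((\<sigma> \<rightarrow> \<sigma>) \<rightarrow> \<sigma>)" for \<sigma>
      using has_type.Const[of "Y \<sigma>" lambda_Y \<Gamma>] by (simp add: lambda_Y_def)
    have "has_type lambda_Y \<Gamma> (?\<delta> c) (const_ty c)" for c
      using const has_type.App[OF const has_type.Lam[OF has_type_Var_0]] by (cases c) auto
    then have "conv lambda_Y \<Gamma> (sub ?\<delta> Var A) (sub ?\<delta> Var t) \<tau>"
      using sub_typed_Var[of lambda_Y \<Gamma> "[]"]
      by (intro conv_sub[OF At]) (auto simp: lambda_Y_def)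
    moreover have "sub ?\<delta> Var A = A"
      using A by (rule sub_ident) (auto simp: lambda_Y_def)
    ultimately show "provably_equal lambda_Y A t"
      by (auto simp: provably_equal_def sub_t)
  }
qed


section \<open>Eliminating \<open>Omega\<close>\<close>

text \<open>
  \<open>absorb \<tau> \<cdot> g \<cdot> x\<close> applies \<open>g : Ground \<rightarrow> \<tau>\<close> to the inhabitant \<open>x z\<^sub>1 \<dots> z\<^sub>p\<close> of \<open>Ground\<close>, where
  \<open>z\<^sub>1, \<dots>, z\<^sub>p\<close> are the arguments that the result is going to receive. Without constants, no closed
  inhabitant of \<open>Ground\<close> is available.
\<close>

primrec absorb :: "ty \<Rightarrow> trm" where
  "absorb Ground = Lam (Ground \<rightarrow> Ground) (Lam Ground (Var 1 \<cdot> Var 0))"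
| "absorb (\<sigma> \<rightarrow> \<tau>) = Lam (Ground \<rightarrow> \<sigma> \<rightarrow> \<tau>) (Lam (\<sigma> \<rightarrow> \<tau>) (Lam \<sigma>
     (absorb \<tau> \<cdot> Lam Ground (Var 3 \<cdot> Var 0 \<cdot> Var 1) \<cdot> (Var 1 \<cdot> Var 0))))"

lemma has_type_nth: "i < length \<Gamma> \<Longrightarrow> \<Gamma> ! i = \<tau> \<Longrightarrow> has_type C \<Gamma> (Var i) \<tau>"
  using has_type.Var by blast

lemma has_type_absorb: "has_type C \<Gamma> (absorb \<tau>) ((Ground \<rightarrow> \<tau>) \<rightarrow> \<tau> \<rightarrow> \<tau>)"
proof (induction \<tau> arbitrary: \<Gamma>)
  case Ground
  show ?case
    unfolding absorb.simps
    by (rule has_type.Lam has_type.App[where \<sigma> = Ground] has_type_nth | simp)+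
next
  case (Fun \<sigma> \<tau>)
  let ?\<Gamma> = "\<sigma> # (\<sigma> \<rightarrow> \<tau>) # (Ground \<rightarrow> \<sigma> \<rightarrow> \<tau>) # \<Gamma>"
  have "has_type C (Ground # ?\<Gamma>) (Var 3 \<cdot> Var 0) (\<sigma> \<rightarrow> \<tau>)"
    by (rule has_type.App[where \<sigma> = Ground]; rule has_type_nth; simp)
  then have "has_type C (Ground # ?\<Gamma>) (Var 3 \<cdot> Var 0 \<cdot> Var 1) \<tau>"
    by (rule has_type.App) (rule has_type_nth; simp)
  moreover have "has_type C ?\<Gamma> (Var 1 \<cdot> Var 0) \<tau>"
    by (rule has_type.App[where \<sigma> = \<sigma>]; rule has_type_nth; simp)
  ultimately show ?case
    unfolding absorb.simps using Fun.IH(2) by (blast intro: has_type.Lam has_type.App)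
qed

lemma sub_absorb [simp]: "sub \<delta> \<rho> (absorb \<tau>) = absorb \<tau>"
  using has_type_absorb[of "{}" "[]"] by (rule sub_ident) auto

lemma lift_absorb [simp]: "lift k (absorb \<tau>) = absorb \<tau>"
  using has_type_absorb by (rule lift_closed)

lemma conv_beta_sub:
  assumes "has_type C (\<sigma> # \<Gamma>) s \<tau>" "sub_typed C \<Delta> \<rho> \<Gamma>" "has_type C \<Delta> u \<sigma>"
  shows "conv C \<Delta> (sub Const \<rho> (Lam \<sigma> s) \<cdot> u) (sub Const (case_nat u \<rho>) s) \<tau>"
  using has_type_sub[OF assms(1) sub_typed_up[OF assms(2)], of Const]
  by (intro conv_sub_beta assms(3)) (auto intro: has_type.Const)

lemma conv_lift_Lam_Var_0:
  assumes "has_type C (\<sigma> # \<Gamma>) s \<tau>"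
  shows "conv C (\<sigma> # \<Gamma>) (lift 0 (Lam \<sigma> s) \<cdot> Var 0) s \<tau>"
proof -
  have "sub_typed C (\<sigma> # \<Gamma>) (\<lambda>i. Var (Suc i)) \<Gamma>"
    by (auto simp: sub_typed_def intro: has_type_nth)
  from conv_beta_sub[OF assms this has_type_Var_0] show ?thesis
    unfolding lift_0_eq_sub by (simp del: sub.simps)
qed

lemma absorb_app:
  assumes g: "has_type C \<Gamma> g (Ground \<rightarrow> \<sigma> \<rightarrow> \<tau>)" and x: "has_type C \<Gamma> x (\<sigma> \<rightarrow> \<tau>)"
    and m: "has_type C \<Gamma> m \<sigma>"
  shows "conv C \<Gamma> (absorb (\<sigma> \<rightarrow> \<tau>) \<cdot> g \<cdot> x \<cdot> m)
    (absorb \<tau> \<cdot> Lam Ground (lift 0 g \<cdot> Var 0 \<cdot> lift 0 m) \<cdot> (x \<cdot> m)) \<tau>"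
proof -
  let ?b = "absorb \<tau> \<cdot> Lam Ground (Var 3 \<cdot> Var 0 \<cdot> Var 1) \<cdot> (Var 1 \<cdot> Var 0)"
  let ?\<rho>1 = "case_nat g Var" let ?\<rho>2 = "case_nat x ?\<rho>1"
  have 1: "has_type C \<Gamma> (Lam (Ground \<rightarrow> \<sigma> \<rightarrow> \<tau>) (Lam (\<sigma> \<rightarrow> \<tau>) (Lam \<sigma> ?b)))
      ((Ground \<rightarrow> \<sigma> \<rightarrow> \<tau>) \<rightarrow> (\<sigma> \<rightarrow> \<tau>) \<rightarrow> \<sigma> \<rightarrow> \<tau>)"
    using has_type_absorb[of C \<Gamma> "\<sigma> \<rightarrow> \<tau>"] by simp
  then have 2: "has_type C ((Ground \<rightarrow> \<sigma> \<rightarrow> \<tau>) # \<Gamma>) (Lam (\<sigma> \<rightarrow> \<tau>) (Lam \<sigma> ?b)) ((\<sigma> \<rightarrow> \<tau>) \<rightarrow> \<sigma> \<rightarrow> \<tau>)"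
    by (blast elim: has_type_LamE)
  then have 3: "has_type C ((\<sigma> \<rightarrow> \<tau>) # (Ground \<rightarrow> \<sigma> \<rightarrow> \<tau>) # \<Gamma>) (Lam \<sigma> ?b) (\<sigma> \<rightarrow> \<tau>)"
    by (blast elim: has_type_LamE)
  then have 4: "has_type C (\<sigma> # (\<sigma> \<rightarrow> \<tau>) # (Ground \<rightarrow> \<sigma> \<rightarrow> \<tau>) # \<Gamma>) ?b \<tau>"
    by (blast elim: has_type_LamE)
  have \<rho>0: "sub_typed C \<Gamma> Var \<Gamma>"
    using sub_typed_Var[of C \<Gamma> "[]"] by simp
  note \<rho>1 = sub_typed_case_nat[OF g \<rho>0]
  note \<rho>2 = sub_typed_case_nat[OF x \<rho>1]
  have "conv C \<Gamma> (absorb (\<sigma> \<rightarrow> \<tau>) \<cdot> g) (sub Const ?\<rho>1 (Lam (\<sigma> \<rightarrow> \<tau>) (Lam \<sigma> ?b))) ((\<sigma> \<rightarrow> \<tau>) \<rightarrow> \<sigma> \<rightarrow> \<tau>)"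
    using conv_beta_sub[OF 2 \<rho>0 g] unfolding sub_Const_Var absorb.simps .
  then have "conv C \<Gamma> (absorb (\<sigma> \<rightarrow> \<tau>) \<cdot> g \<cdot> x) (sub Const ?\<rho>1 (Lam (\<sigma> \<rightarrow> \<tau>) (Lam \<sigma> ?b)) \<cdot> x) (\<sigma> \<rightarrow> \<tau>)"
    by (rule conv.app[OF _ conv.refl[OF x]])
  then have "conv C \<Gamma> (absorb (\<sigma> \<rightarrow> \<tau>) \<cdot> g \<cdot> x) (sub Const ?\<rho>2 (Lam \<sigma> ?b)) (\<sigma> \<rightarrow> \<tau>)"
    by (rule conv.trans[OF _ conv_beta_sub[OF 3 \<rho>1 x]])
  then have "conv C \<Gamma> (absorb (\<sigma> \<rightarrow> \<tau>) \<cdot> g \<cdot> x \<cdot> m) (sub Const ?\<rho>2 (Lam \<sigma> ?b) \<cdot> m) \<tau>"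
    by (rule conv.app[OF _ conv.refl[OF m]])
  then have "conv C \<Gamma> (absorb (\<sigma> \<rightarrow> \<tau>) \<cdot> g \<cdot> x \<cdot> m) (sub Const (case_nat m ?\<rho>2) ?b) \<tau>"
    by (rule conv.trans[OF _ conv_beta_sub[OF 4 \<rho>2 m]])
  then show ?thesis
    by simp
qed

text \<open>If \<open>g\<close> ignores its argument up to conversion, it does not matter which
  inhabitant \<open>absorb\<close> supplies. At \<open>Ground\<close> the inhabitant is
  \<open>x\<close> and is substituted into the assumption; at a function type a fresh argument is
  supplied and removed again by extensionality.\<close>

lemma absorb_const:
  assumes "has_type C \<Gamma> g (Ground \<rightarrow> \<tau>)" "has_type C \<Gamma> x \<tau>" "has_type C \<Gamma> c \<tau>"
    and "conv C (Ground # \<Gamma>) (lift 0 g \<cdot> Var 0) (lift 0 c) \<tau>"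
  shows "conv C \<Gamma> (absorb \<tau> \<cdot> g \<cdot> x) c \<tau>"
  using assms
proof (induction \<tau> arbitrary: \<Gamma> g x c)
  case Ground
  have \<rho>0: "sub_typed C \<Gamma> Var \<Gamma>"
    using sub_typed_Var[of C \<Gamma> "[]"] by simp
  note \<rho>1 = sub_typed_case_nat[OF Ground(1) \<rho>0]
  have 2: "has_type C (Ground # (Ground \<rightarrow> Ground) # \<Gamma>) (Var 1 \<cdot> Var 0) Ground"
    by (rule has_type.App[where \<sigma> = Ground]; rule has_type_nth; simp)
  note 1 = has_type.Lam[OF 2]
  have "conv C \<Gamma> (absorb Ground \<cdot> g) (sub Const (case_nat g Var) (Lam Ground (Var 1 \<cdot> Var 0))) (Ground \<rightarrow> Ground)"
    using conv_beta_sub[OF 1 \<rho>0 Ground(1)] unfolding sub_Const_Var absorb.simps .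
  from conv.trans[OF conv.app[OF this conv.refl[OF Ground(2)]] conv_beta_sub[OF 2 \<rho>1 Ground(2)]]
  have "conv C \<Gamma> (absorb Ground \<cdot> g \<cdot> x) (g \<cdot> x) Ground"
    by simp
  moreover have "conv C \<Gamma> (g \<cdot> x) c Ground"
    using conv_sub[OF Ground(4) sub_typed_case_nat[OF Ground(2) \<rho>0], of Const]
    by (simp add: sub_case_nat_lift has_type.Const)
  ultimately show ?case
    by (rule conv.trans)
next
  case (Fun \<sigma> \<tau>)
  note g = Fun.prems(1) and x = Fun.prems(2) and c = Fun.prems(3)
  let ?\<Gamma> = "\<sigma> # \<Gamma>"
  let ?b = "lift 0 (lift 0 g) \<cdot> Var 0 \<cdot> Var 1"
  have g'': "has_type C (Ground # ?\<Gamma>) (lift 0 (lift 0 g)) (Ground \<rightarrow> \<sigma> \<rightarrow> \<tau>)"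
    using g by (intro has_type_lift_0)
  have v1: "has_type C (Ground # ?\<Gamma>) (Var 1) \<sigma>"
    by (rule has_type_nth) auto
  have b: "has_type C (Ground # ?\<Gamma>) ?b \<tau>"
    using has_type.App[OF has_type.App[OF g'' has_type_Var_0] v1] .
  \<comment> \<open>The fresh argument enters the context behind the ground variable, which is why
    this renaming is used under \<open>up\<close>.\<close>
  have "sub_typed C ?\<Gamma> (\<lambda>i. Var (Suc i)) \<Gamma>"
    by (auto simp: sub_typed_def intro: has_type_nth)
  from conv_sub[OF Fun.prems(4) sub_typed_up[OF this], of Const]
  have "conv C (Ground # ?\<Gamma>) (lift 0 (lift 0 g) \<cdot> Var 0) (lift 0 (lift 0 c)) (\<sigma> \<rightarrow> \<tau>)"
    by (simp add: lift_eq_sub sub_sub has_type.Const)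
  then have "conv C (Ground # ?\<Gamma>) ?b (lift 0 (lift 0 c) \<cdot> Var 1) \<tau>"
    by (rule conv.app[OF _ conv.refl[OF v1]])
  with conv_lift_Lam_Var_0[OF b]
  have "conv C (Ground # ?\<Gamma>) (lift 0 (Lam Ground ?b) \<cdot> Var 0) (lift 0 (lift 0 c) \<cdot> Var 1) \<tau>"
    by (rule conv.trans)
  then have "conv C (Ground # ?\<Gamma>) (lift 0 (Lam Ground ?b) \<cdot> Var 0) (lift 0 (lift 0 c \<cdot> Var 0)) \<tau>"
    by simp
  then have "conv C ?\<Gamma> (absorb \<tau> \<cdot> Lam Ground ?b \<cdot> (lift 0 x \<cdot> Var 0)) (lift 0 c \<cdot> Var 0) \<tau>"
    using has_type.Lam[OF b] has_type.App[OF has_type_lift_0[OF x] has_type_Var_0]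
      has_type.App[OF has_type_lift_0[OF c] has_type_Var_0] by (intro Fun.IH(2))
  moreover have "conv C ?\<Gamma> (absorb (\<sigma> \<rightarrow> \<tau>) \<cdot> lift 0 g \<cdot> lift 0 x \<cdot> Var 0)
      (absorb \<tau> \<cdot> Lam Ground ?b \<cdot> (lift 0 x \<cdot> Var 0)) \<tau>"
    using absorb_app[OF has_type_lift_0[OF g] has_type_lift_0[OF x] has_type_Var_0]
    by (simp del: absorb.simps)
  ultimately have "conv C ?\<Gamma> (lift 0 (absorb (\<sigma> \<rightarrow> \<tau>) \<cdot> g \<cdot> x) \<cdot> Var 0) (lift 0 c \<cdot> Var 0) \<tau>"
    by (simp del: absorb.simps) (blast intro: conv.trans)
  then show ?case
    using has_type.App[OF has_type.App[OF has_type_absorb g] x] c by (rule conv_ext)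
qed

section \<open>Absorption after a list of arguments\<close>

lemma has_type_foldl:
  "has_type C \<Gamma> s (foldr (\<rightarrow>) \<sigma>s \<tau>) \<Longrightarrow> list_all2 (has_type C \<Gamma>) ts \<sigma>s \<Longrightarrow>
    has_type C \<Gamma> (foldl (\<cdot>) s ts) \<tau>"
  by (induction \<sigma>s arbitrary: s ts) (auto simp: list_all2_Cons2, metis has_type.App)

lemma conv_foldl:
  "conv C \<Gamma> s s' (foldr (\<rightarrow>) \<sigma>s \<tau>) \<Longrightarrow> list_all2 (has_type C \<Gamma>) ts \<sigma>s \<Longrightarrow>
    conv C \<Gamma> (foldl (\<cdot>) s ts) (foldl (\<cdot>) s' ts) \<tau>"
  by (induction \<sigma>s arbitrary: s s' ts) (auto simp: list_all2_Cons2, metis conv.app conv.refl)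

text \<open>\<open>absorb_app\<close> moves the arguments one by one under the abstraction over
  \<open>Ground\<close>. Thus \<open>g\<close> has to ignore its first argument only after receiving
  all of \<open>ts\<close>, which for a total function is known when \<open>ts\<close> are
  numerals.\<close>

lemma absorb_foldl:
  assumes "has_type C \<Gamma> g (Ground \<rightarrow> foldr (\<rightarrow>) \<sigma>s \<tau>)" "has_type C \<Gamma> x (foldr (\<rightarrow>) \<sigma>s \<tau>)"
    and "has_type C \<Gamma> c \<tau>" "list_all2 (has_type C \<Gamma>) ts \<sigma>s"
    and "conv C (Ground # \<Gamma>) (foldl (\<cdot>) (lift 0 g \<cdot> Var 0) (map (lift 0) ts)) (lift 0 c) \<tau>"
  shows "conv C \<Gamma> (foldl (\<cdot>) (absorb (foldr (\<rightarrow>) \<sigma>s \<tau>) \<cdot> g \<cdot> x) ts) c \<tau>"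
  using assms
proof (induction \<sigma>s arbitrary: g x ts)
  case Nil
  then show ?case
    by (auto intro: absorb_const)
next
  case (Cons \<sigma> \<sigma>s)
  let ?\<tau> = "foldr (\<rightarrow>) \<sigma>s \<tau>"
  obtain m ms where ts: "ts = m # ms" and m: "has_type C \<Gamma> m \<sigma>" and ms: "list_all2 (has_type C \<Gamma>) ms \<sigma>s"
    using Cons.prems(4) by (auto simp: list_all2_Cons2)
  have g: "has_type C \<Gamma> g (Ground \<rightarrow> \<sigma> \<rightarrow> ?\<tau>)" and x: "has_type C \<Gamma> x (\<sigma> \<rightarrow> ?\<tau>)"
    using Cons.prems(1,2) by auto
  let ?b = "lift 0 g \<cdot> Var 0 \<cdot> lift 0 m"
  have b: "has_type C (Ground # \<Gamma>) ?b ?\<tau>"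
    using has_type.App[OF has_type.App[OF has_type_lift_0[OF g] has_type_Var_0] has_type_lift_0[OF m]] .
  have ms': "list_all2 (has_type C (Ground # \<Gamma>)) (map (lift 0) ms) \<sigma>s"
    using ms by (auto simp: list_all2_map1 intro: has_type_lift_0 elim!: list_all2_mono)
  have "conv C (Ground # \<Gamma>) (foldl (\<cdot>) (lift 0 (Lam Ground ?b) \<cdot> Var 0) (map (lift 0) ms)) (lift 0 c) \<tau>"
    using conv.trans[OF conv_foldl[OF conv_lift_Lam_Var_0[OF b] ms']] Cons.prems(5) ts by simp
  then have "conv C \<Gamma> (foldl (\<cdot>) (absorb ?\<tau> \<cdot> Lam Ground ?b \<cdot> (x \<cdot> m)) ms) c \<tau>"
    using has_type.Lam[OF b] has_type.App[OF x m] Cons.prems(3) ms by (intro Cons.IH)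
  from conv.trans[OF conv_foldl[OF absorb_app[OF g x m] ms] this] show ?case
    by (simp add: ts)
qed

section \<open>Numerals as arguments, and passage to the \<open>Omega\<close> calculus\<close>

lemma numerals_typed:
  "length ms = length \<alpha>s \<Longrightarrow> list_all2 (has_type C \<Gamma>) (map2 church \<alpha>s ms) (map omega \<alpha>s)"
  by (auto simp: list_all2_conv_all_nth has_type_church)

lemma sub_church [simp]: "sub \<delta> \<rho> (church \<alpha> m) = church \<alpha> m"
  using has_type_church[of "{}" "[]"] by (rule sub_ident) auto

lemma lift_church [simp]: "lift k (church \<alpha> m) = church \<alpha> m"
  using has_type_church by (rule lift_closed)

lemma consts_of_subset: "has_type C \<Gamma> t \<tau> \<Longrightarrow> consts_of t \<subseteq> C"
  by (induction rule: has_type.induct) auto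

lemma consts_of_foldl: "consts_of (foldl (\<cdot>) s ts) = consts_of s \<union> \<Union> (consts_of ` set ts)"
  by (induction ts arbitrary: s) auto

lemma consts_of_church [simp]: "consts_of (church \<alpha> m) = {}"
  using consts_of_subset[OF has_type_church[of "{}" "[]"]] by simp

lemma sub_foldl_numerals:
  "sub \<delta> \<rho> (foldl (\<cdot>) F (map2 church \<alpha>s ms)) = foldl (\<cdot>) (sub \<delta> \<rho> F) (map2 church \<alpha>s ms)"
  by (simp add: sub_foldl_app comp_def case_prod_unfold)

text \<open>The depth is chosen from the constants of \<open>F\<close> alone. Numerals contribute
  none, so it is exact for all applications of \<open>F\<close> to numerals at once.\<close>

lemma defines_fun_unroll:
  assumes "defines_fun lambda_Y \<alpha>s \<alpha> F f"
  shows "\<exists>n. defines_fun lambda_Omega \<alpha>s \<alpha> (sub (unroll n) Var F) f"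
proof -
  let ?\<tau> = "foldr (\<rightarrow>) (map omega \<alpha>s) (omega \<alpha>)"
  have F: "has_type lambda_Y [] F ?\<tau>"
    and f: "\<And>ms m. length ms = length \<alpha>s \<Longrightarrow>
      f ms = Some m \<longleftrightarrow> provably_equal lambda_Y (foldl (\<cdot>) F (map2 church \<alpha>s ms)) (church \<alpha> m)"
    using assms by (auto simp: defines_fun_def)
  obtain n where n: "\<forall>c\<in>consts_of F. \<forall>\<eta>. eval \<eta> (unroll n c) = cval c"
    using eventually_eval_unroll by blast
  have "has_type lambda_Omega [] (sub (unroll n) Var F) ?\<tau>"
    using F by (rule has_type_sub_unroll) (simp add: sub_typed_def)
  moreover have "f ms = Some m \<longleftrightarrow>
      provably_equal lambda_Omega (foldl (\<cdot>) (sub (unroll n) Var F) (map2 church \<alpha>s ms)) (church \<alpha> m)"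
    if len: "length ms = length \<alpha>s" for ms m
  proof -
    let ?A = "foldl (\<cdot>) F (map2 church \<alpha>s ms)"
    have A: "has_type lambda_Y [] ?A (omega \<alpha>)"
      using F numerals_typed[OF len] by (rule has_type_foldl)
    have "\<forall>c\<in>consts_of ?A. \<forall>\<eta>. eval \<eta> (unroll n c) = cval c"
      using n by (auto simp: consts_of_foldl)
    from provably_equal_unroll_iff[OF A has_type_church this] f[OF len] show ?thesis
      by (simp add: sub_foldl_numerals)
  qed
  ultimately show ?thesis
    by (auto simp: defines_fun_def)
qed

section \<open>Provable equality of closed terms across contexts\<close>

lemma conv_append_left:
  assumes "conv C \<Gamma> s t \<tau>" "has_type C [] s \<tau>" "has_type C [] t \<tau>"
  shows "conv C (\<Delta> @ \<Gamma>) s t \<tau>"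
proof -
  have "sub_typed C (\<Delta> @ \<Gamma>) (\<lambda>i. Var (length \<Delta> + i)) \<Gamma>"
    by (auto simp: sub_typed_def intro!: has_type_nth)
  from conv_sub[OF assms(1) this, of Const]
  have "conv C (\<Delta> @ \<Gamma>) (sub Const (\<lambda>i. Var (length \<Delta> + i)) s) (sub Const (\<lambda>i. Var (length \<Delta> + i)) t) \<tau>"
    by (simp add: has_type.Const)
  moreover have "sub Const \<rho> u = u" if "has_type C [] u \<tau>" for \<rho> u
    using that by (rule sub_ident) auto
  ultimately show ?thesis
    using assms by simp
qed

text \<open>The two equations may be derived in different contexts. As the terms are closed, both
  derivations can be moved to the concatenation of the contexts.\<close>

lemma provably_equal_trans:
  assumes "provably_equal C s t" "provably_equal C t u"
    and s: "has_type C [] s \<tau>" and t: "has_type C [] t \<tau>" and u: "has_type C [] u \<tau>"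
  shows "provably_equal C s u"
proof -
  obtain \<Gamma> \<sigma> \<Gamma>' \<sigma>' where st: "conv C \<Gamma> s t \<sigma>" and tu: "conv C \<Gamma>' t u \<sigma>'"
    using assms by (auto simp: provably_equal_def)
  have "\<sigma> = \<tau>" "\<sigma>' = \<tau>"
    using conv_has_type[OF st] conv_has_type[OF tu] has_type_closed[OF t] has_type_unique by blast+
  then have "conv C (\<Gamma> @ \<Gamma>') s t \<tau>" "conv C (\<Gamma> @ \<Gamma>') t u \<tau>"
    using conv_weaken[OF st order.refl] conv_append_left[OF _ t u] tu by auto
  then show ?thesis
    unfolding provably_equal_def by (blast intro: conv.trans)
qed

lemma provably_equal_sym: "provably_equal C s t \<Longrightarrow> provably_equal C t s"
  by (auto simp: provably_equal_def intro: conv.sym)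

lemma provably_equal_mono: "provably_equal C s t \<Longrightarrow> C \<subseteq> C' \<Longrightarrow> provably_equal C' s t"
  unfolding provably_equal_def by (blast intro: conv_weaken)

text \<open>\<open>Omega\<close> becomes a variable, abstracted by \<open>g\<close>. Whenever
  \<open>H\<close> yields a numeral, replacing \<open>Omega\<close> in the derivation leaves the
  numeral unchanged, so \<open>g\<close> applied to those arguments ignores the variable and
  \<open>absorb\<close> may fill it.\<close>

lemma Omega_elimination:
  assumes H: "has_type lambda_Omega [] H (foldr (\<rightarrow>) (map omega \<alpha>s) (omega \<alpha>))"
  obtains H' where "has_type {} [] H' (foldr (\<rightarrow>) (map omega \<alpha>s) (omega \<alpha>))"
    and "\<And>ms m. length ms = length \<alpha>s \<Longrightarrow>
      provably_equal lambda_Omega (foldl (\<cdot>) H (map2 church \<alpha>s ms)) (church \<alpha> m) \<Longrightarrow>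
      provably_equal {} (foldl (\<cdot>) H' (map2 church \<alpha>s ms)) (church \<alpha> m)"
proof
  let ?\<tau> = "foldr (\<rightarrow>) (map omega \<alpha>s) (omega \<alpha>)"
  \<comment> \<open>The variable standing for \<open>Omega\<close> takes index 0, so the variables
    of the given derivation move up by one.\<close>
  let ?\<delta> = "\<lambda>_::cnst. Var 0" and ?\<rho> = "\<lambda>i. Var (Suc i)"
  define b where "b = sub ?\<delta> ?\<rho> H"
  define g where "g = Lam Ground b"
  \<comment> \<open>Any pure closed term of the type of \<open>H\<close> will do; this one discards
    its arguments and returns the numeral zero.\<close>
  define x where "x = foldr Lam (map omega \<alpha>s) (church \<alpha> 0)"
  have b: "has_type {} (Ground # \<Gamma>) b ?\<tau>" for \<Gamma>
    unfolding b_def using H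
    by (rule has_type_sub) (auto simp: sub_typed_def lambda_Omega_def has_type_Var_0)
  have g: "has_type {} \<Gamma> g (Ground \<rightarrow> ?\<tau>)" for \<Gamma>
    unfolding g_def using b by (rule has_type.Lam)
  have x: "has_type {} \<Gamma> x ?\<tau>" for \<Gamma>
    unfolding x_def by (induction \<alpha>s arbitrary: \<Gamma>) (auto intro: has_type_church has_type.Lam)
  let ?H' = "absorb ?\<tau> \<cdot> g \<cdot> x"
  show "has_type {} [] ?H' ?\<tau>"
    using has_type.App[OF has_type.App[OF has_type_absorb g] x] .
  fix ms :: "nat list" and m :: nat
  assume len: "length ms = length \<alpha>s"
  let ?ts = "map2 church \<alpha>s ms"
  assume "provably_equal lambda_Omega (foldl (\<cdot>) H ?ts) (church \<alpha> m)"
  then obtain \<Gamma> \<sigma> where conv: "conv lambda_Omega \<Gamma> (foldl (\<cdot>) H ?ts) (church \<alpha> m) \<sigma>"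
    by (auto simp: provably_equal_def)
  then have \<sigma>: "\<sigma> = omega \<alpha>"
    using conv_has_type has_type_church has_type_unique by blast
  have "conv {} (Ground # \<Gamma>) (sub ?\<delta> ?\<rho> (foldl (\<cdot>) H ?ts)) (sub ?\<delta> ?\<rho> (church \<alpha> m)) \<sigma>"
    using conv by (rule conv_sub)
      (auto simp: sub_typed_def lambda_Omega_def has_type_Var_0 intro: has_type_nth)
  then have 1: "conv {} (Ground # \<Gamma>) (foldl (\<cdot>) b ?ts) (church \<alpha> m) (omega \<alpha>)"
    by (simp add: \<sigma> sub_foldl_numerals b_def)
  have 2: "conv {} (Ground # \<Gamma>) (foldl (\<cdot>) (lift 0 g \<cdot> Var 0) ?ts) (foldl (\<cdot>) b ?ts) (omega \<alpha>)"
    unfolding g_def using conv_lift_Lam_Var_0[OF b] numerals_typed[OF len] by (rule conv_foldl)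
  have "map (lift 0) ?ts = ?ts"
    by (simp add: comp_def case_prod_unfold)
  then have "conv {} (Ground # \<Gamma>) (foldl (\<cdot>) (lift 0 g \<cdot> Var 0) (map (lift 0) ?ts))
      (lift 0 (church \<alpha> m)) (omega \<alpha>)"
    using conv.trans[OF 2 1] by (simp only: lift_church)
  then have "conv {} \<Gamma> (foldl (\<cdot>) ?H' ?ts) (church \<alpha> m) (omega \<alpha>)"
    using g x has_type_church numerals_typed[OF len] by (intro absorb_foldl)
  then show "provably_equal {} (foldl (\<cdot>) ?H' ?ts) (church \<alpha> m)"
    by (auto simp: provably_equal_def)
qed

theorem theorem1:
  fixes \<alpha>s :: "ty list" and \<alpha> :: ty
  shows "(\<forall>f :: nat list \<Rightarrow> nat option.
            definable lambda_Y \<alpha>s \<alpha> f \<longrightarrow> definable lambda_Omega \<alpha>s \<alpha> f) \<and>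
         (\<forall>f :: nat list \<Rightarrow> nat.
            definable lambda_Y \<alpha>s \<alpha> (\<lambda>ms. Some (f ms)) \<longrightarrow>
            definable lambda_beta_eta \<alpha>s \<alpha> (\<lambda>ms. Some (f ms)))"
proof (intro conjI allI impI)
  fix f :: "nat list \<Rightarrow> nat option"
  assume "definable lambda_Y \<alpha>s \<alpha> f"
  then show "definable lambda_Omega \<alpha>s \<alpha> f"
    using defines_fun_unroll unfolding definable_def by blast
next
  fix f :: "nat list \<Rightarrow> nat"
  let ?\<tau> = "foldr (\<rightarrow>) (map omega \<alpha>s) (omega \<alpha>)" and ?ts = "map2 church \<alpha>s"
  assume "definable lambda_Y \<alpha>s \<alpha> (\<lambda>ms. Some (f ms))"
  then obtain F H where F: "defines_fun lambda_Y \<alpha>s \<alpha> F (\<lambda>ms. Some (f ms))"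
    and H: "defines_fun lambda_Omega \<alpha>s \<alpha> H (\<lambda>ms. Some (f ms))"
    using defines_fun_unroll unfolding definable_def by blast
  obtain H' where H': "has_type {} [] H' ?\<tau>"
    and eq: "\<And>ms m. length ms = length \<alpha>s \<Longrightarrow>
      provably_equal lambda_Omega (foldl (\<cdot>) H (?ts ms)) (church \<alpha> m) \<Longrightarrow>
      provably_equal {} (foldl (\<cdot>) H' (?ts ms)) (church \<alpha> m)"
    using Omega_elimination[of H \<alpha>s \<alpha>] H unfolding defines_fun_def by blast
  have "f ms = m \<longleftrightarrow> provably_equal {} (foldl (\<cdot>) H' (?ts ms)) (church \<alpha> m)"
    if len: "length ms = length \<alpha>s" for ms m
  proof
    have f: "provably_equal {} (foldl (\<cdot>) H' (?ts ms)) (church \<alpha> (f ms))"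
      using eq[OF len] H len unfolding defines_fun_def by blast
    then show "provably_equal {} (foldl (\<cdot>) H' (?ts ms)) (church \<alpha> m)" if "f ms = m"
      using that by simp
    assume m: "provably_equal {} (foldl (\<cdot>) H' (?ts ms)) (church \<alpha> m)"
    \<comment> \<open>A conversion between the two numerals is carried over to the \<open>Y\<close>
      calculus, where \<open>F\<close> then yields both of them; the defining property of
      \<open>F\<close> forces \<open>f ms = m\<close>.\<close>
    have "provably_equal {} (church \<alpha> (f ms)) (church \<alpha> m)"
      using provably_equal_sym[OF f] m has_type_church
        has_type_foldl[OF H' numerals_typed[OF len]] has_type_church
      by (rule provably_equal_trans)
    then have fm: "provably_equal lambda_Y (church \<alpha> (f ms)) (church \<alpha> m)"
      by (rule provably_equal_mono) simp
    have "has_type lambda_Y [] F ?\<tau>"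
      using F unfolding defines_fun_def by blast
    then have F_type: "has_type lambda_Y [] (foldl (\<cdot>) F (?ts ms)) (omega \<alpha>)"
      using numerals_typed[OF len] by (rule has_type_foldl)
    have "provably_equal lambda_Y (foldl (\<cdot>) F (?ts ms)) (church \<alpha> (f ms))"
      using F len unfolding defines_fun_def by blast
    then have "provably_equal lambda_Y (foldl (\<cdot>) F (?ts ms)) (church \<alpha> m)"
      using fm F_type has_type_church has_type_church by (rule provably_equal_trans)
    then show "f ms = m"
      using F len unfolding defines_fun_def by blast
  qed
  then show "definable lambda_beta_eta \<alpha>s \<alpha> (\<lambda>ms. Some (f ms))"
    using H' unfolding definable_def defines_fun_def lambda_beta_eta_def by auto
qed

end
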